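(* Let $M$ be an oriented maximal surface in the Minkowski space $\mathbb E^4_1$. Then $M$ has (global) 1-type Gauss map of the first kind if and only if the Gauss map $\nu$ of $M$ is harmonic.
   Context: $\mathbb E^4_1$ is $\mathbb R^4$ with the metric $-dx_1^2+dx_2^2+dx_3^2+dx_4^2$. A surface $M$ is space-like if every nonzero tangent vector $v$ satisfies $\langle v,v\rangle>0$. The second fundamental form $h$ is defined by $\widetilde\nabla_XY=\nabla_XY+h(X,Y)$ and the mean curvature vector is $H=\frac12(h(e_1,e_1)+h(e_2,e_2))$ for an orthonormal tangent frame. A maximal surface is a space-like surface with $H=0$ identically. The Gauss map is $\nu=e_3\wedge e_4:M\to\bigwedge^2\mathbb E^4_1$, where $\{e_1,e_2,e_3,e_4\}$ is an oriented local orthonormal frame with $e_1,e_2$ tangent and $e_3,e_4$ normal to $M$; $\bigwedge^2\mathbb E^4_1$ is identified with a pseudo-Euclidean space via $\langle f_1\wedge f_2,g_1\wedge g_2\rangle=\det(\langle f_i,g_j\rangle)$. The Laplacian $\Delta=\sum_{i=1}^2(\nabla_{e_i}e_i-e_ie_i)$ of $M$ acts componentwise on $\nu$; $\nu$ is harmonic if $\Delta\nu=0$. $M$ has (global) 1-type Gauss map of the first kind if $\Delta\nu=\lambda\nu$ for some constant $\lambda\in\mathbb R$ ($\lambda=0$ allowed). *)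

theory Defs
  imports "HOL-Analysis.Analysis"
begin

section \<open>Smooth maps\<close>

primrec differentiable_upto ::
    "nat \<Rightarrow> 'a::real_normed_vector set \<Rightarrow> ('a \<Rightarrow> 'b::real_normed_vector) \<Rightarrow> bool" where
  "differentiable_upto 0 U f \<longleftrightarrow> continuous_on U f"
| "differentiable_upto (Suc n) U f \<longleftrightarrow>
     (\<forall>x\<in>U. f differentiable (at x)) \<and>
     (\<forall>v. differentiable_upto n U (\<lambda>x. frechet_derivative f (at x) v))"

text \<open>Only used on open subsets of finite-dimensional spaces, where it is the usual
  \<open>C\<^sup>\<infinity>\<close> condition.\<close>
definition smooth_on ::
    "'a::real_normed_vector set \<Rightarrow> ('a \<Rightarrow> 'b::real_normed_vector) \<Rightarrow> bool" where
  "smooth_on U f \<longleftrightarrow> (\<forall>n. differentiable_upto n U f)"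


section \<open>The Minkowski space and its bivectors\<close>

type_synonym minkowski = "real^4"

definition mink :: "minkowski \<Rightarrow> minkowski \<Rightarrow> real" where
  "mink v w = - (v $ 1 * w $ 1) + v $ 2 * w $ 2 + v $ 3 * w $ 3 + v $ 4 * w $ 4"

text \<open>The second exterior power is modelled by the skew-symmetric \<open>4 \<times> 4\<close> matrices, with
  \<open>v \<and> w = v w\<^sup>T - w v\<^sup>T\<close>.\<close>
type_synonym bivector = "real^4^4"

definition wedge :: "minkowski \<Rightarrow> minkowski \<Rightarrow> bivector" where
  "wedge v w = (\<chi> i j. v $ i * w $ j - v $ j * w $ i)"


section \<open>Oriented immersed surfaces\<close>

text \<open>An abstract surface with an atlas of local parametrizations \<open>\<psi> : V \<rightarrow> M\<close>, \<open>V\<close> open in the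
  plane, together with a map \<open>pos\<close> into the Minkowski space.  No global injectivity of \<open>pos\<close> is
  assumed, so vector fields and functions live on the abstract surface, while tangent vectors
  are identified with their images under the differential of \<open>pos\<close>.\<close>
record 'a surface =
  top_space :: "'a topology"
  atlas :: "((real^2) set \<times> (real^2 \<Rightarrow> 'a)) set"
  pos :: "'a \<Rightarrow> minkowski"

abbreviation points :: "'a surface \<Rightarrow> 'a set" where
  "points S \<equiv> topspace (top_space S)"

definition oriented_atlas :: "'a topology \<Rightarrow> ((real^2) set \<times> (real^2 \<Rightarrow> 'a)) set \<Rightarrow> bool" where
  "oriented_atlas M A \<longleftrightarrow>
     (\<forall>(V, \<psi>)\<in>A. open V \<and> openin M (\<psi> ` V) \<and>
        homeomorphic_map (top_of_set V) (subtopology M (\<psi> ` V)) \<psi>) \<and>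
     (\<Union>(V, \<psi>)\<in>A. \<psi> ` V) = topspace M \<and>
     (\<forall>(V, \<psi>)\<in>A. \<forall>(W, \<phi>)\<in>A.
        smooth_on (V \<inter> \<psi> -` (\<phi> ` W)) (inv_into W \<phi> \<circ> \<psi>) \<and>
        (\<forall>u\<in>V \<inter> \<psi> -` (\<phi> ` W).
           det (matrix (frechet_derivative (inv_into W \<phi> \<circ> \<psi>) (at u))) > 0))"

definition smooth_map_on ::
    "'a surface \<Rightarrow> 'a set \<Rightarrow> ('a \<Rightarrow> 'b::real_normed_vector) \<Rightarrow> bool" where
  "smooth_map_on S Q f \<longleftrightarrow> (\<forall>(V, \<psi>)\<in>atlas S. smooth_on (V \<inter> \<psi> -` Q) (f \<circ> \<psi>))"

definition oriented_surface :: "'a surface \<Rightarrow> bool" where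
  "oriented_surface S \<longleftrightarrow>
     Hausdorff_space (top_space S) \<and> second_countable (top_space S) \<and>
     oriented_atlas (top_space S) (atlas S) \<and>
     smooth_map_on S (points S) (pos S) \<and>
     (\<forall>(V, \<psi>)\<in>atlas S. \<forall>u\<in>V. inj (frechet_derivative (pos S \<circ> \<psi>) (at u)))"

definition tangent_plane :: "'a surface \<Rightarrow> 'a \<Rightarrow> minkowski set" where
  "tangent_plane S p =
     {w. \<exists>V \<psi> u a. (V, \<psi>) \<in> atlas S \<and> u \<in> V \<and> \<psi> u = p \<and>
           w = frechet_derivative (pos S \<circ> \<psi>) (at u) a}"

definition space_like :: "'a surface \<Rightarrow> bool" where
  "space_like S \<longleftrightarrow> (\<forall>p\<in>points S. \<forall>v\<in>tangent_plane S p. v \<noteq> 0 \<longrightarrow> mink v v > 0)"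

text \<open>The derivative at \<open>p\<close> of a function \<open>f\<close> on the surface in the direction of the tangent
  vector \<open>w\<close>.  By the chain rule it does not depend on the parametrization.\<close>
definition dir_deriv ::
    "'a surface \<Rightarrow> ('a \<Rightarrow> 'b::real_normed_vector) \<Rightarrow> 'a \<Rightarrow> minkowski \<Rightarrow> 'b" where
  "dir_deriv S f p w =
     (THE d. \<exists>V \<psi> u a. (V, \<psi>) \<in> atlas S \<and> u \<in> V \<and> \<psi> u = p \<and>
        w = frechet_derivative (pos S \<circ> \<psi>) (at u) a \<and>
        d = frechet_derivative (f \<circ> \<psi>) (at u) a)"


section \<open>Levi-Civita connection, second fundamental form, mean curvature\<close>

definition tan_part :: "'a surface \<Rightarrow> 'a \<Rightarrow> minkowski \<Rightarrow> minkowski" where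
  "tan_part S p w =
     (THE t. t \<in> tangent_plane S p \<and> (\<forall>s\<in>tangent_plane S p. mink (w - t) s = 0))"

text \<open>The Gauss formula: the flat derivative \<open>dir_deriv S Y p (X p)\<close> of a tangent field \<open>Y\<close>
  splits into its tangential part (the Levi-Civita connection of the induced metric) and its
  normal part (the second fundamental form).\<close>
definition connection ::
    "'a surface \<Rightarrow> ('a \<Rightarrow> minkowski) \<Rightarrow> ('a \<Rightarrow> minkowski) \<Rightarrow> 'a \<Rightarrow> minkowski" where
  "connection S X Y p = tan_part S p (dir_deriv S Y p (X p))"

definition second_fundamental_form ::
    "'a surface \<Rightarrow> ('a \<Rightarrow> minkowski) \<Rightarrow> ('a \<Rightarrow> minkowski) \<Rightarrow> 'a \<Rightarrow> minkowski" where
  "second_fundamental_form S X Y p = dir_deriv S Y p (X p) - connection S X Y p"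

definition local_tangent_frame ::
    "'a surface \<Rightarrow> 'a set \<Rightarrow> ('a \<Rightarrow> minkowski) \<Rightarrow> ('a \<Rightarrow> minkowski) \<Rightarrow> bool" where
  "local_tangent_frame S Q e1 e2 \<longleftrightarrow>
     openin (top_space S) Q \<and> smooth_map_on S Q e1 \<and> smooth_map_on S Q e2 \<and>
     (\<forall>q\<in>Q. e1 q \<in> tangent_plane S q \<and> e2 q \<in> tangent_plane S q \<and>
        mink (e1 q) (e1 q) = 1 \<and> mink (e2 q) (e2 q) = 1 \<and> mink (e1 q) (e2 q) = 0)"

text \<open>On a space-like surface the values below do not depend on the local orthonormal frame,
  so the descriptions are proper.\<close>
definition mean_curvature :: "'a surface \<Rightarrow> 'a \<Rightarrow> minkowski" where
  "mean_curvature S p =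
     (THE w. \<exists>Q e1 e2. p \<in> Q \<and> local_tangent_frame S Q e1 e2 \<and>
        w = (1/2) *\<^sub>R (second_fundamental_form S e1 e1 p + second_fundamental_form S e2 e2 p))"

definition maximal_surface :: "'a surface \<Rightarrow> bool" where
  "maximal_surface S \<longleftrightarrow> space_like S \<and> (\<forall>p\<in>points S. mean_curvature S p = 0)"

definition laplacian ::
    "'a surface \<Rightarrow> ('a \<Rightarrow> 'b::real_normed_vector) \<Rightarrow> 'a \<Rightarrow> 'b" where
  "laplacian S f p =
     (THE w. \<exists>Q e1 e2. p \<in> Q \<and> local_tangent_frame S Q e1 e2 \<and>
        w = (\<Sum>e\<leftarrow>[e1, e2]. dir_deriv S f p (connection S e e p)
                          - dir_deriv S (\<lambda>q. dir_deriv S f q (e q)) p (e p)))"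


section \<open>The Gauss map\<close>

definition positive_tangent_basis :: "'a surface \<Rightarrow> 'a \<Rightarrow> minkowski \<Rightarrow> minkowski \<Rightarrow> bool" where
  "positive_tangent_basis S p v w \<longleftrightarrow>
     (\<exists>V \<psi> u a b. (V, \<psi>) \<in> atlas S \<and> u \<in> V \<and> \<psi> u = p \<and>
        v = frechet_derivative (pos S \<circ> \<psi>) (at u) a \<and>
        w = frechet_derivative (pos S \<circ> \<psi>) (at u) b \<and>
        det (vector [a, b] :: real^2^2) > 0)"

text \<open>Since \<open>e3, e4\<close> span a Lorentzian plane, one of them is time-like; which one is left open.\<close>
definition adapted_frame_at ::
    "'a surface \<Rightarrow> 'a \<Rightarrow> minkowski \<Rightarrow> minkowski \<Rightarrow> minkowski \<Rightarrow> minkowski \<Rightarrow> bool" where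
  "adapted_frame_at S p e1 e2 e3 e4 \<longleftrightarrow>
     positive_tangent_basis S p e1 e2 \<and>
     (\<forall>v\<in>tangent_plane S p. mink e3 v = 0 \<and> mink e4 v = 0) \<and>
     mink e1 e1 = 1 \<and> mink e2 e2 = 1 \<and> mink e1 e2 = 0 \<and>
     \<bar>mink e3 e3\<bar> = 1 \<and> \<bar>mink e4 e4\<bar> = 1 \<and> mink e3 e4 = 0 \<and>
     det (vector [e1, e2, e3, e4] :: real^4^4) > 0"

text \<open>Two adapted frames at \<open>p\<close> have normal parts related by a matrix of determinant \<open>1\<close>, so
  \<open>e3 \<and> e4\<close> depends on \<open>p\<close> only.\<close>
definition gauss_map :: "'a surface \<Rightarrow> 'a \<Rightarrow> bivector" where
  "gauss_map S p = (THE \<omega>. \<exists>e1 e2 e3 e4. adapted_frame_at S p e1 e2 e3 e4 \<and> \<omega> = wedge e3 e4)"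

definition has_one_type_gauss_map_first_kind :: "'a surface \<Rightarrow> bool" where
  "has_one_type_gauss_map_first_kind S \<longleftrightarrow>
     (\<exists>c::real. \<forall>p\<in>points S. laplacian S (gauss_map S) p = c *\<^sub>R gauss_map S p)"

definition harmonic :: "'a surface \<Rightarrow> ('a \<Rightarrow> 'b::real_normed_vector) \<Rightarrow> bool" where
  "harmonic S f \<longleftrightarrow> (\<forall>p\<in>points S. laplacian S f p = 0)"

end

theory Submission
  imports Defs
begin

text \<open>Identify the bivectors of the Minkowski space with \<open>\<complex>\<^sup>3\<close>, the Hodge star being multiplication by
  \<open>\<i>\<close> up to sign, and let \<open>n\<close> be the image of the Gauss map in the complex sphere \<open>n \<cdot> n = 1\<close>. On a
  maximal surface \<open>n\<close> is conformal for the complex bilinear product, and \<open>\<Delta>\<nu> = \<lambda>\<nu>\<close> makes the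
  conformal factor equal to \<open>\<lambda>/2\<close>. If \<open>\<lambda> \<noteq> 0\<close>, then \<open>n\<close> and its two partial derivatives form an
  orthogonal basis of \<open>\<complex>\<^sup>3\<close>, so the induced metric of the surface has the Gauss curvature \<open>\<lambda>/2\<close> of a
  complex sphere. But the Gauss equation of a maximal surface gives the curvature \<open>- \<lambda>/2\<close>.\<close>

section \<open>Calculus of smooth maps\<close>

text \<open>The normal planes are Lorentzian, so the squares of normal vectors have no sign and
  \<open>lam = 0\<close> cannot follow from positivity; it follows from one curvature having two
  values of opposite sign. If \<open>lam \<noteq> 0\<close>, the two derivatives of \<open>n\<close>
  are orthogonal and not isotropic, and the complex sphere has complex dimension two. They therefore
  span its tangent space over the complex numbers, and \<open>n\<close> itself is the only normal
  direction left, as for a real surface in three-space. The metric that \<open>n\<close> induces is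
  \<open>lam / 2\<close> times that of the surface, which turns the curvature 1 of the unit sphere
  into \<open>lam / 2\<close>. Curvature itself is never defined: the Gauss equations of
  \<open>F\<close> and \<open>n\<close> are compared at one point. The derivatives there are taken
  in constant directions of the parameter plane, orthonormal at that point only. They commute; the
  price is Christoffel terms, which agree for \<open>F\<close> and \<open>n\<close> and
  cancel.\<close>

definition pd :: "'a::real_normed_vector \<Rightarrow> ('a \<Rightarrow> 'b::real_normed_vector) \<Rightarrow> 'a \<Rightarrow> 'b" where
  "pd v f x = frechet_derivative f (at x) v"

lemma differentiable_upto_Suc_pd:
  "differentiable_upto (Suc n) U f \<longleftrightarrow>
     (\<forall>x\<in>U. f differentiable (at x)) \<and> (\<forall>v. differentiable_upto n U (pd v f))"
  by (simp add: pd_def[abs_def])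

declare differentiable_upto.simps(2) [simp del]

lemma has_derivative_pd_iff:
  "f differentiable (at x) \<longleftrightarrow> (f has_derivative (\<lambda>v. pd v f x)) (at x)"
  unfolding pd_def by (auto simp: frechet_derivative_works differentiable_def)

lemma pd_eqI: "(f has_derivative f') (at x) \<Longrightarrow> pd v f x = f' v"
  unfolding pd_def using frechet_derivative_at by metis

lemma linear_pd: "f differentiable (at x) \<Longrightarrow> linear (\<lambda>v. pd v f x)"
  using has_derivative_pd_iff has_derivative_linear by blast

lemma has_derivative_cong_open:
  assumes "open U" "x \<in> U" "\<And>y. y \<in> U \<Longrightarrow> f y = g y"
  shows "(f has_derivative f') (at x) \<longleftrightarrow> (g has_derivative f') (at x)"
  using has_derivative_transform_within_open[of f f' x UNIV U g]
    has_derivative_transform_within_open[of g f' x UNIV U f] assms by auto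

lemma differentiable_cong_open:
  assumes "open U" "x \<in> U" "\<And>y. y \<in> U \<Longrightarrow> f y = g y"
  shows "f differentiable (at x) \<longleftrightarrow> g differentiable (at x)"
  unfolding differentiable_def using has_derivative_cong_open[OF assms] by simp

lemma pd_cong_open:
  assumes "open U" "x \<in> U" "\<And>y. y \<in> U \<Longrightarrow> f y = g y"
  shows "pd v f x = pd v g x"
  unfolding pd_def frechet_derivative_def using has_derivative_cong_open[OF assms] by simp

lemma differentiable_upto_cong:
  assumes "open U" "\<And>y. y \<in> U \<Longrightarrow> f y = g y"
  shows "differentiable_upto n U f \<longleftrightarrow> differentiable_upto n U g"
  using assms(2)
proof (induction n arbitrary: f g)
  case 0
  then show ?case by (simp cong: continuous_on_cong)
next
  case (Suc n)
  have "differentiable_upto n U (pd v f) \<longleftrightarrow> differentiable_upto n U (pd v g)" for v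
    by (rule Suc.IH) (rule pd_cong_open[OF assms(1)], auto simp: Suc.prems)
  moreover have "\<forall>x\<in>U. f differentiable (at x) \<longleftrightarrow> g differentiable (at x)"
    using differentiable_cong_open[OF assms(1)] Suc.prems by blast
  ultimately show ?case unfolding differentiable_upto_Suc_pd by blast
qed

lemma differentiable_upto_Suc_D:
  "differentiable_upto (Suc n) U f \<Longrightarrow> differentiable_upto n U f"
proof (induction n arbitrary: f)
  case 0
  then show ?case
    by (auto simp: differentiable_upto_Suc_pd
        intro!: continuous_at_imp_continuous_on differentiable_imp_continuous_within)
next
  case (Suc n)
  then show ?case by (simp add: differentiable_upto_Suc_pd[of "Suc n"]
        differentiable_upto_Suc_pd[of n U f])
qed

lemma smooth_on_differentiable: "smooth_on U f \<Longrightarrow> x \<in> U \<Longrightarrow> f differentiable (at x)"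
  unfolding smooth_on_def by (metis differentiable_upto_Suc_pd)

lemma smooth_on_pd: "smooth_on U f \<Longrightarrow> smooth_on U (pd v f)"
  unfolding smooth_on_def by (metis differentiable_upto_Suc_pd)

lemma smooth_on_has_derivative:
  "smooth_on U f \<Longrightarrow> x \<in> U \<Longrightarrow> (f has_derivative (\<lambda>v. pd v f x)) (at x)"
  by (simp add: smooth_on_differentiable flip: has_derivative_pd_iff)

lemma smooth_on_continuous_on: "smooth_on U f \<Longrightarrow> continuous_on U f"
  unfolding smooth_on_def using differentiable_upto.simps(1) by blast

lemma smooth_on_cong:
  "open U \<Longrightarrow> (\<And>y. y \<in> U \<Longrightarrow> f y = g y) \<Longrightarrow> smooth_on U f \<longleftrightarrow> smooth_on U g"
  unfolding smooth_on_def using differentiable_upto_cong by blast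

lemma differentiable_upto_subset:
  "differentiable_upto n U f \<Longrightarrow> U' \<subseteq> U \<Longrightarrow> differentiable_upto n U' f"
  by (induction n arbitrary: f) (auto simp: differentiable_upto_Suc_pd continuous_on_subset)

lemma smooth_on_subset: "smooth_on U f \<Longrightarrow> U' \<subseteq> U \<Longrightarrow> smooth_on U' f"
  unfolding smooth_on_def using differentiable_upto_subset by blast

section \<open>Closure properties of smooth maps\<close>

lemma differentiable_upto_const: "differentiable_upto n U (\<lambda>x::'a::real_normed_vector. c)"
proof (induction n arbitrary: c)
  case (Suc n)
  have "pd v (\<lambda>x::'a. c) = (\<lambda>x. 0)" for v
    by (intro ext pd_eqI) (rule has_derivative_const)
  then show ?case using Suc by (simp add: differentiable_upto_Suc_pd)
qed simp

lemma smooth_on_const: "smooth_on U (\<lambda>x. c)"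
  unfolding smooth_on_def using differentiable_upto_const by blast

lemma pd_add:
  "f differentiable (at x) \<Longrightarrow> g differentiable (at x) \<Longrightarrow>
     pd v (\<lambda>x. f x + g x) x = pd v f x + pd v g x"
  by (rule pd_eqI) (auto simp: has_derivative_pd_iff intro!: derivative_eq_intros)

lemma pd_diff:
  "f differentiable (at x) \<Longrightarrow> g differentiable (at x) \<Longrightarrow>
     pd v (\<lambda>x. f x - g x) x = pd v f x - pd v g x"
  by (rule pd_eqI) (auto simp: has_derivative_pd_iff intro!: derivative_eq_intros)

lemma pd_bounded_linear:
  "bounded_linear L \<Longrightarrow> f differentiable (at x) \<Longrightarrow> pd v (\<lambda>x. L (f x)) x = L (pd v f x)"
  by (rule pd_eqI) (auto simp: has_derivative_pd_iff intro: bounded_linear.has_derivative)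

lemma pd_bilinear:
  "bounded_bilinear B \<Longrightarrow> f differentiable (at x) \<Longrightarrow> g differentiable (at x) \<Longrightarrow>
     pd v (\<lambda>x. B (f x) (g x)) x = B (f x) (pd v g x) + B (pd v f x) (g x)"
  by (rule pd_eqI) (auto simp: has_derivative_pd_iff intro: bounded_bilinear.FDERIV)

lemma pd_compose:
  assumes "g differentiable (at x)" "f differentiable (at (g x))"
  shows "pd v (\<lambda>x. f (g x)) x = pd (pd v g x) f (g x)"
  by (rule pd_eqI) (use assms in \<open>auto simp: has_derivative_pd_iff intro: has_derivative_compose\<close>)

lemma differentiable_upto_add:
  assumes U: "open U"
  shows "differentiable_upto n U f \<Longrightarrow> differentiable_upto n U g \<Longrightarrow>
    differentiable_upto n U (\<lambda>x. f x + g x)"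
proof (induction n arbitrary: f g)
  case 0
  then show ?case by (simp add: continuous_on_add)
next
  case (Suc n)
  have "differentiable_upto n U (pd v (\<lambda>x. f x + g x))" for v
  proof -
    have "differentiable_upto n U (\<lambda>x. pd v f x + pd v g x)"
      using Suc by (auto simp: differentiable_upto_Suc_pd)
    then show ?thesis
      by (subst differentiable_upto_cong[OF U])
        (use Suc in \<open>auto simp: differentiable_upto_Suc_pd pd_add\<close>)
  qed
  then show ?case using Suc.prems by (auto simp: differentiable_upto_Suc_pd)
qed

lemma smooth_on_add:
  "open U \<Longrightarrow> smooth_on U f \<Longrightarrow> smooth_on U g \<Longrightarrow> smooth_on U (\<lambda>x. f x + g x)"
  unfolding smooth_on_def using differentiable_upto_add by blast

lemma differentiable_upto_sum:
  "open U \<Longrightarrow> (\<And>i. i \<in> I \<Longrightarrow> differentiable_upto n U (f i)) \<Longrightarrow>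
     differentiable_upto n U (\<lambda>x. \<Sum>i\<in>I. f i x)"
  by (induction I rule: infinite_finite_induct)
    (auto simp: differentiable_upto_const intro: differentiable_upto_add)

lemma differentiable_bilinear:
  "bounded_bilinear B \<Longrightarrow> f differentiable (at x) \<Longrightarrow> g differentiable (at x) \<Longrightarrow>
     (\<lambda>x. B (f x) (g x)) differentiable (at x)"
  unfolding differentiable_def using bounded_bilinear.FDERIV by blast

lemma differentiable_upto_bilinear:
  assumes U: "open U" and B: "bounded_bilinear B"
  shows "differentiable_upto n U f \<Longrightarrow> differentiable_upto n U g \<Longrightarrow>
    differentiable_upto n U (\<lambda>x. B (f x) (g x))"
proof (induction n arbitrary: f g)
  case 0
  then show ?case by (simp add: bounded_bilinear.continuous_on[OF B])
next
  case (Suc n)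
  have "differentiable_upto n U (pd v (\<lambda>x. B (f x) (g x)))" for v
  proof -
    have "differentiable_upto n U (\<lambda>x. B (f x) (pd v g x) + B (pd v f x) (g x))"
      using Suc by (intro differentiable_upto_add U)
        (meson differentiable_upto_Suc_D differentiable_upto_Suc_pd)+
    then show ?thesis
      by (subst differentiable_upto_cong[OF U])
        (use Suc in \<open>auto simp: differentiable_upto_Suc_pd pd_bilinear[OF B]\<close>)
  qed
  moreover have "\<forall>x\<in>U. (\<lambda>x. B (f x) (g x)) differentiable (at x)"
    using Suc.prems differentiable_bilinear[OF B] unfolding differentiable_upto_Suc_pd by blast
  ultimately show ?case by (simp add: differentiable_upto_Suc_pd)
qed

lemma smooth_on_bilinear:
  "open U \<Longrightarrow> bounded_bilinear B \<Longrightarrow> smooth_on U f \<Longrightarrow> smooth_on U g \<Longrightarrow>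
     smooth_on U (\<lambda>x. B (f x) (g x))"
  unfolding smooth_on_def using differentiable_upto_bilinear by blast

lemmas smooth_on_scaleR = smooth_on_bilinear[OF _ bounded_bilinear_scaleR]
lemmas smooth_on_mult = smooth_on_bilinear[OF _ bounded_bilinear_mult]

lemma smooth_on_bounded_linear:
  assumes U: "open U" and L: "bounded_linear L" and f: "smooth_on U f"
  shows "smooth_on U (\<lambda>x. L (f x))"
proof -
  \<comment> \<open>A linear map is read as a product with the constant factor 1, which saves a
    separate induction over the order of differentiability.\<close>
  have "bounded_bilinear (\<lambda>(r::real) y. r *\<^sub>R L y)"
    by (rule bounded_bilinear.comp[OF bounded_bilinear_scaleR bounded_linear_ident L])
  from smooth_on_bilinear[OF U this smooth_on_const[of U 1] f] show ?thesis by simp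
qed

lemma smooth_on_diff:
  assumes "open U" "smooth_on U f" "smooth_on U g"
  shows "smooth_on U (\<lambda>x. f x - g x)"
  using smooth_on_add[OF assms(1,2) smooth_on_bounded_linear[OF assms(1)
        bounded_linear_minus[OF bounded_linear_ident] assms(3)]] by simp

lemma has_derivative_powr_const:
  fixes f :: "'a::real_normed_vector \<Rightarrow> real"
  assumes "f differentiable (at x)" "f x > 0"
  shows "((\<lambda>x. f x powr r) has_derivative (\<lambda>v. (r * f x powr (r - 1)) * pd v f x)) (at x)"
  using has_derivative_powr[OF assms(1)[unfolded has_derivative_pd_iff] has_derivative_const
      assms(2), of r] assms(2)
  by (simp add: powr_diff field_simps)

text \<open>Differentiation lowers the exponent, so the induction runs over all \<open>r\<close> at
  once. The exponent used later is \<open>-1/2\<close>, the normalization of lengths and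
  areas.\<close>

lemma smooth_on_powr:
  fixes f :: "'a::real_normed_vector \<Rightarrow> real"
  assumes U: "open U" and f: "smooth_on U f" and pos: "\<And>x. x \<in> U \<Longrightarrow> f x > 0"
  shows "smooth_on U (\<lambda>x. f x powr r)"
proof -
  have der: "((\<lambda>x. f x powr r) has_derivative (\<lambda>v. (r * f x powr (r - 1)) * pd v f x)) (at x)"
    if "x \<in> U" for x r
    using has_derivative_powr_const[OF smooth_on_differentiable[OF f that] pos[OF that]] .
  have "differentiable_upto n U (\<lambda>x. f x powr r)" for n
  proof (induction n arbitrary: r)
    case 0
    show ?case using smooth_on_continuous_on[OF f] pos
      by (force intro!: continuous_intros)
  next
    case (Suc n)
    have "differentiable_upto n U (pd v (\<lambda>x. f x powr r))" for v
    proof -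
      have "differentiable_upto n U (\<lambda>x. (r * f x powr (r - 1)) * pd v f x)"
        using smooth_on_pd[OF f] Suc
        by (intro differentiable_upto_bilinear[OF U bounded_bilinear_mult]
            differentiable_upto_const) (auto simp: smooth_on_def)
      then show ?thesis
        by (subst differentiable_upto_cong[OF U]) (auto simp: pd_eqI[OF der])
    qed
    then show ?case using der by (auto simp: differentiable_upto_Suc_pd differentiable_def)
  qed
  then show ?thesis by (simp add: smooth_on_def)
qed

text \<open>The chain rule gives a derivative of \<open>f\<close> in the direction
  \<open>pd v g x\<close>, which varies with \<open>x\<close>. Expanding this direction in the basis
  leaves derivatives of \<open>f\<close> in constant directions, to which the induction hypothesis
  applies.\<close>

lemma differentiable_upto_compose:
  fixes g :: "'a::real_normed_vector \<Rightarrow> 'b::euclidean_space"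
  assumes U: "open U" and gUW: "g ` U \<subseteq> W"
  shows "differentiable_upto n W f \<Longrightarrow> differentiable_upto n U g \<Longrightarrow>
    differentiable_upto n U (\<lambda>x. f (g x))"
proof (induction n arbitrary: f)
  case 0
  then show ?case using continuous_on_compose2[of W f U g] gUW by simp
next
  case (Suc n)
  have g: "g differentiable (at x)" and f: "f differentiable (at (g x))" if "x \<in> U" for x
    using that Suc.prems gUW by (auto simp: differentiable_upto_Suc_pd)
  have "differentiable_upto n U (pd v (\<lambda>x. f (g x)))" for v
  proof -
    have "differentiable_upto n U (\<lambda>x. \<Sum>b\<in>Basis. (pd v g x \<bullet> b) *\<^sub>R pd b f (g x))"
    proof (intro differentiable_upto_sum U
        differentiable_upto_bilinear[OF U bounded_bilinear_scaleR]
        differentiable_upto_bilinear[OF U bounded_bilinear_inner] differentiable_upto_const)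
      show "differentiable_upto n U (pd v g)"
        using Suc.prems by (simp add: differentiable_upto_Suc_pd)
      show "differentiable_upto n U (\<lambda>x. pd b f (g x))" for b
        using Suc.prems by (intro Suc.IH)
          (auto intro: differentiable_upto_Suc_D simp: differentiable_upto_Suc_pd[of n W])
    qed
    moreover have "pd v (\<lambda>x. f (g x)) x = (\<Sum>b\<in>Basis. (pd v g x \<bullet> b) *\<^sub>R pd b f (g x))"
      if "x \<in> U" for x
    proof -
      interpret linear "\<lambda>v. pd v f (g x)" by (rule linear_pd[OF f[OF that]])
      have "pd (\<Sum>b\<in>Basis. (pd v g x \<bullet> b) *\<^sub>R b) f (g x) =
          (\<Sum>b\<in>Basis. (pd v g x \<bullet> b) *\<^sub>R pd b f (g x))"
        by (simp add: sum scale)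
      then show ?thesis using pd_compose[OF g[OF that] f[OF that]]
        by (simp add: euclidean_representation)
    qed
    ultimately show ?thesis by (subst differentiable_upto_cong[OF U]) auto
  qed
  moreover have "(\<lambda>x. f (g x)) differentiable (at x)" if "x \<in> U" for x
    using differentiable_compose[of f g x UNIV] g[OF that] f[OF that] by simp
  ultimately show ?case by (simp add: differentiable_upto_Suc_pd)
qed

lemma smooth_on_compose:
  fixes g :: "'a::real_normed_vector \<Rightarrow> 'b::euclidean_space"
  shows "open U \<Longrightarrow> smooth_on W f \<Longrightarrow> smooth_on U g \<Longrightarrow> g ` U \<subseteq> W \<Longrightarrow>
    smooth_on U (\<lambda>x. f (g x))"
  unfolding smooth_on_def using differentiable_upto_compose by blast

text \<open>Both mixed derivatives are limits of the second difference quotient of \<open>f\<close>.\<close>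
lemma pd_commute_real:
  fixes f :: "'a::real_normed_vector \<Rightarrow> real"
  assumes U: "open U" and x: "x \<in> U" and f: "smooth_on U f"
  shows "pd v (pd w f) x = pd w (pd v f) x"
proof -
  define m where "m s v w = (f (x + s *\<^sub>R v + s *\<^sub>R w) - f (x + s *\<^sub>R v)) - (f (x + s *\<^sub>R w) - f x)"
    for s v w
  have line: "((\<lambda>t. h (y + t *\<^sub>R v)) has_real_derivative pd v h (y + t *\<^sub>R v)) (at t)"
    if "smooth_on U h" "y + t *\<^sub>R v \<in> U" for h :: "'a \<Rightarrow> real" and y v t
  proof -
    have "((\<lambda>t. y + t *\<^sub>R v) has_derivative (\<lambda>s. s *\<^sub>R v)) (at t)"
      by (auto intro!: derivative_eq_intros)
    from has_derivative_compose[OF this smooth_on_has_derivative[OF that]]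
    have "((\<lambda>t. h (y + t *\<^sub>R v)) has_derivative (\<lambda>s. pd (s *\<^sub>R v) h (y + t *\<^sub>R v))) (at t)" .
    moreover have "pd (s *\<^sub>R v) h (y + t *\<^sub>R v) = pd v h (y + t *\<^sub>R v) * s" for s
      using linear_cmul[OF linear_pd[OF smooth_on_differentiable[OF that]]] by simp
    ultimately show ?thesis by (simp add: has_field_derivative_def)
  qed
  \<comment> \<open>The mean value theorem is used twice: along \<open>v\<close> for the increment
    \<open>G\<close> of \<open>f\<close> in the direction \<open>s *\<^sub>R w\<close>, then along
    \<open>w\<close>. As \<open>m\<close> is symmetric in \<open>v\<close> and \<open>w\<close>,
    exchanging them expresses the same number by the other mixed derivative.\<close>
  have key: "\<exists>y. norm (y - x) \<le> s * (norm v + norm w) \<and> m s v w = s * s * pd w (pd v f) y"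
    if s: "s > 0" and sub: "cball x (s * (norm v + norm w)) \<subseteq> U" for s v w
  proof -
    have inU: "x + a *\<^sub>R v + b *\<^sub>R w \<in> U" "norm ((x + a *\<^sub>R v + b *\<^sub>R w) - x) \<le> s * (norm v + norm w)"
      if "0 \<le> a" "a \<le> s" "0 \<le> b" "b \<le> s" for a b
    proof -
      have "norm (a *\<^sub>R v + b *\<^sub>R w) \<le> norm (a *\<^sub>R v) + norm (b *\<^sub>R w)" by (rule norm_triangle_ineq)
      also have "\<dots> \<le> s * norm v + s * norm w"
        using that by (auto intro!: add_mono mult_right_mono)
      finally have *: "norm (a *\<^sub>R v + b *\<^sub>R w) \<le> s * (norm v + norm w)" by (simp add: algebra_simps)
      then show "norm ((x + a *\<^sub>R v + b *\<^sub>R w) - x) \<le> s * (norm v + norm w)" by (simp add: add.assoc)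
      have "dist x (x + a *\<^sub>R v + b *\<^sub>R w) = norm (a *\<^sub>R v + b *\<^sub>R w)"
        by (metis add.assoc dist_commute dist_norm add_diff_cancel_left')
      with * show "x + a *\<^sub>R v + b *\<^sub>R w \<in> U" using sub by (auto simp: subset_iff)
    qed
    define G where "G t = f (x + s *\<^sub>R w + t *\<^sub>R v) - f (x + t *\<^sub>R v)" for t
    have "\<exists>z. 0 < z \<and> z < s \<and>
      G s - G 0 = (s - 0) * (pd v f (x + s *\<^sub>R w + z *\<^sub>R v) - pd v f (x + z *\<^sub>R v))"
    proof (rule MVT2[OF s])
      fix t assume t: "0 \<le> t" "t \<le> s"
      show "(G has_real_derivative pd v f (x + s *\<^sub>R w + t *\<^sub>R v) - pd v f (x + t *\<^sub>R v)) (at t)"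
        unfolding G_def[abs_def] using inU(1)[of t s] inU(1)[of t 0] t s
        by (intro DERIV_diff line f) (auto simp: algebra_simps)
    qed
    then obtain z where z: "0 < z" "z < s"
      "G s - G 0 = s * (pd v f (x + s *\<^sub>R w + z *\<^sub>R v) - pd v f (x + z *\<^sub>R v))" by auto
    have "\<exists>y. 0 < y \<and> y < s \<and> pd v f (x + z *\<^sub>R v + s *\<^sub>R w) - pd v f (x + z *\<^sub>R v + 0 *\<^sub>R w)
      = (s - 0) * pd w (pd v f) (x + z *\<^sub>R v + y *\<^sub>R w)"
      using inU(1) z by (intro MVT2[OF s] line smooth_on_pd f) auto
    then obtain y where y: "0 < y" "y < s"
      "pd v f (x + z *\<^sub>R v + s *\<^sub>R w) - pd v f (x + z *\<^sub>R v) = s * pd w (pd v f) (x + z *\<^sub>R v + y *\<^sub>R w)"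
      by auto
    have "m s v w = G s - G 0" by (simp add: m_def G_def algebra_simps)
    also have "\<dots> = s * s * pd w (pd v f) (x + z *\<^sub>R v + y *\<^sub>R w)"
      using z(3) y(3) by (simp add: algebra_simps)
    finally show ?thesis using inU(2)[of z y] y z by (intro exI[of _ "x + z *\<^sub>R v + y *\<^sub>R w"]) auto
  qed
  have "\<bar>pd v (pd w f) x - pd w (pd v f) x\<bar> \<le> e" if "e > 0" for e
  proof -
    have cont: "isCont (pd a (pd b f)) x" for a b
      using smooth_on_continuous_on[OF smooth_on_pd[OF smooth_on_pd[OF f]]] U x
      by (simp add: continuous_on_eq_continuous_at)
    obtain d1 where d1: "d1 > 0" "\<And>y. dist y x < d1 \<Longrightarrow> dist (pd v (pd w f) y) (pd v (pd w f) x) < e/2"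
      using cont[of v w] \<open>e > 0\<close> unfolding continuous_at_eps_delta by (meson half_gt_zero)
    obtain d2 where d2: "d2 > 0" "\<And>y. dist y x < d2 \<Longrightarrow> dist (pd w (pd v f) y) (pd w (pd v f) x) < e/2"
      using cont[of w v] \<open>e > 0\<close> unfolding continuous_at_eps_delta by (meson half_gt_zero)
    obtain d3 where d3: "d3 > 0" "cball x d3 \<subseteq> U" using U x open_contains_cball by blast
    define d where "d = min d3 (min d1 d2) / 2"
    \<comment> \<open>The summand 1 keeps the divisor positive when \<open>v\<close> and
      \<open>w\<close> both vanish.\<close>
    define s where "s = d / (norm v + norm w + 1)"
    have d: "0 < d" "d < d1" "d < d2" "d \<le> d3" using d1 d2 d3 by (auto simp: d_def)
    have pos: "0 < norm v + norm w + 1" by (simp add: add_nonneg_pos)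
    have s: "s > 0" using d(1) pos by (simp add: s_def)
    have "s * (norm v + norm w) \<le> s * (norm v + norm w + 1)" using s by simp
    also have "\<dots> = d" using pos by (simp add: s_def)
    finally have sd: "s * (norm v + norm w) \<le> d" .
    have sub: "cball x (s * (norm v + norm w)) \<subseteq> U"
      using sd d d3(2) by (meson order_trans subset_cball)
    obtain y1 where y1: "norm (y1 - x) \<le> s * (norm v + norm w)" "m s v w = s * s * pd w (pd v f) y1"
      using key[OF s sub] by blast
    obtain y2 where y2: "norm (y2 - x) \<le> s * (norm w + norm v)" "m s w v = s * s * pd v (pd w f) y2"
      using key[OF s, of w v] sub by (auto simp: add.commute)
    have "m s v w = m s w v" by (simp add: m_def algebra_simps)
    then have "pd w (pd v f) y1 = pd v (pd w f) y2" using y1 y2 s by simp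
    moreover have "dist (pd w (pd v f) y1) (pd w (pd v f) x) < e/2"
      using y1(1) sd d by (intro d2) (auto simp: dist_norm)
    moreover have "dist (pd v (pd w f) y2) (pd v (pd w f) x) < e/2"
      using y2(1) sd d by (intro d1) (auto simp: dist_norm add.commute)
    ultimately show ?thesis unfolding dist_real_def by argo
  qed
  then have "\<bar>pd v (pd w f) x - pd w (pd v f) x\<bar> \<le> 0" by (rule field_le_epsilon[where y=0, simplified])
  then show ?thesis by simp
qed

lemma pd_commute:
  fixes f :: "'a::real_normed_vector \<Rightarrow> 'b::euclidean_space"
  assumes U: "open U" and x: "x \<in> U" and f: "smooth_on U f"
  shows "pd v (pd w f) x = pd w (pd v f) x"
proof (rule euclidean_eqI)
  fix b :: 'b
  assume "b \<in> Basis"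
  have comp: "pd v (\<lambda>x. g x \<bullet> b) y = pd v g y \<bullet> b" if "smooth_on U g" "y \<in> U" for g v y
    using pd_bounded_linear[OF bounded_linear_inner_left smooth_on_differentiable[OF that]] .
  have comp2: "pd v (pd w (\<lambda>x. f x \<bullet> b)) x = pd v (pd w f) x \<bullet> b" for v w
  proof -
    have "pd v (pd w (\<lambda>x. f x \<bullet> b)) x = pd v (\<lambda>x. pd w f x \<bullet> b) x"
      by (rule pd_cong_open[OF U x]) (rule comp[OF f])
    then show ?thesis using comp[OF smooth_on_pd[OF f] x] by simp
  qed
  have "smooth_on U (\<lambda>x. f x \<bullet> b)"
    by (rule smooth_on_bounded_linear[OF U bounded_linear_inner_left f])
  from pd_commute_real[OF U x this] show "pd v (pd w f) x \<bullet> b = pd w (pd v f) x \<bullet> b"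
    unfolding comp2 .
qed

section \<open>Derivatives along a variable direction\<close>

lemma pd_expand:
  fixes a :: "'a::euclidean_space"
  assumes "f differentiable (at y)"
  shows "pd a f y = (\<Sum>i\<in>Basis. (a \<bullet> i) *\<^sub>R pd i f y)"
proof -
  interpret linear "\<lambda>v. pd v f y" by (rule linear_pd[OF assms])
  have "pd (\<Sum>i\<in>Basis. (a \<bullet> i) *\<^sub>R i) f y = (\<Sum>i\<in>Basis. (a \<bullet> i) *\<^sub>R pd i f y)"
    by (simp add: sum scale)
  then show ?thesis by (simp add: euclidean_representation)
qed

lemma smooth_on_sum:
  "open U \<Longrightarrow> (\<And>i. i \<in> I \<Longrightarrow> smooth_on U (f i)) \<Longrightarrow> smooth_on U (\<lambda>x. \<Sum>i\<in>I. f i x)"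
  unfolding smooth_on_def using differentiable_upto_sum[of U I] by blast

lemma pd_sum:
  "(\<And>i. i \<in> I \<Longrightarrow> f i differentiable (at x)) \<Longrightarrow>
     pd v (\<lambda>x. \<Sum>i\<in>I. f i x) x = (\<Sum>i\<in>I. pd v (f i) x)"
  by (rule pd_eqI) (auto simp: has_derivative_pd_iff intro!: has_derivative_sum)

text \<open>A tangent field has variable coordinates \<open>a\<close> in a chart. The product rule
  separates the derivative of \<open>a\<close> from the second derivative of \<open>f\<close> with
  the direction frozen at \<open>x\<close>; only the latter survives in the geometric
  quantities.\<close>

lemma
  fixes f :: "'a::euclidean_space \<Rightarrow> 'b::real_normed_vector"
  assumes U: "open U" and a: "smooth_on U a" and f: "smooth_on U f"
  shows smooth_on_pd_field: "smooth_on U (\<lambda>y. pd (a y) f y)"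
    and pd_pd_field: "x \<in> U \<Longrightarrow> pd v (\<lambda>y. pd (a y) f y) x = pd (pd v a x) f x + pd v (pd (a x) f) x"
proof -
  have ai: "smooth_on U (\<lambda>y. a y \<bullet> i)" for i
    by (rule smooth_on_bounded_linear[OF U bounded_linear_inner_left a])
  have fi: "smooth_on U (pd i f)" for i by (rule smooth_on_pd[OF f])
  have trm: "smooth_on U (\<lambda>y. (a y \<bullet> i) *\<^sub>R pd i f y)" for i
    by (rule smooth_on_scaleR[OF U ai fi])
  have eq: "pd (b y) f y = (\<Sum>i\<in>Basis. (b y \<bullet> i) *\<^sub>R pd i f y)" if "y \<in> U" for b y
    by (rule pd_expand[OF smooth_on_differentiable[OF f that]])
  show "smooth_on U (\<lambda>y. pd (a y) f y)"
    by (subst smooth_on_cong[OF U eq], assumption) (rule smooth_on_sum[OF U trm])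
  assume x: "x \<in> U"
  have "pd v (\<lambda>y. pd (a y) f y) x = pd v (\<lambda>y. \<Sum>i\<in>Basis. (a y \<bullet> i) *\<^sub>R pd i f y) x"
    by (rule pd_cong_open[OF U x eq])
  also have "\<dots> = (\<Sum>i\<in>Basis. pd v (\<lambda>y. (a y \<bullet> i) *\<^sub>R pd i f y) x)"
    by (rule pd_sum) (rule smooth_on_differentiable[OF trm x])
  also have "\<dots> = (\<Sum>i\<in>Basis. (a x \<bullet> i) *\<^sub>R pd v (pd i f) x + (pd v a x \<bullet> i) *\<^sub>R pd i f x)"
  proof (rule sum.cong[OF refl])
    fix i
    show "pd v (\<lambda>y. (a y \<bullet> i) *\<^sub>R pd i f y) x = (a x \<bullet> i) *\<^sub>R pd v (pd i f) x + (pd v a x \<bullet> i) *\<^sub>R pd i f x"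
      using pd_bilinear[OF bounded_bilinear_scaleR smooth_on_differentiable[OF ai x]
          smooth_on_differentiable[OF fi x]]
        pd_bounded_linear[OF bounded_linear_inner_left smooth_on_differentiable[OF a x], of v i]
      by simp
  qed
  also have "\<dots> = (\<Sum>i\<in>Basis. (a x \<bullet> i) *\<^sub>R pd v (pd i f) x) + pd (pd v a x) f x"
    by (simp add: sum.distrib eq[OF x, of "\<lambda>_. pd v a x"])
  also have "(\<Sum>i\<in>Basis. (a x \<bullet> i) *\<^sub>R pd v (pd i f) x) = pd v (pd (a x) f) x"
  proof -
    have "pd v (pd (a x) f) x = pd v (\<lambda>y. \<Sum>i\<in>Basis. (a x \<bullet> i) *\<^sub>R pd i f y) x"
      by (rule pd_cong_open[OF U x]) (rule eq[of _ "\<lambda>_. a x"])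
    also have "\<dots> = (\<Sum>i\<in>Basis. pd v (\<lambda>y. (a x \<bullet> i) *\<^sub>R pd i f y) x)"
      by (rule pd_sum, rule smooth_on_differentiable[OF _ x])
        (rule smooth_on_scaleR[OF U smooth_on_const fi])
    also have "\<dots> = (\<Sum>i\<in>Basis. (a x \<bullet> i) *\<^sub>R pd v (pd i f) x)"
      by (intro sum.cong refl pd_bounded_linear bounded_linear_scaleR_right
          smooth_on_differentiable[OF fi x])
    finally show ?thesis by simp
  qed
  finally show "pd v (\<lambda>y. pd (a y) f y) x = pd (pd v a x) f x + pd v (pd (a x) f) x"
    by (simp add: add.commute)
qed

section \<open>Bivectors of the Minkowski space\<close>

lemma vector_4 [simp]:
  "(vector [a, b, c, d] :: 'a::zero^4) $ 1 = a" "(vector [a, b, c, d] :: 'a^4) $ 2 = b"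
  "(vector [a, b, c, d] :: 'a^4) $ 3 = c" "(vector [a, b, c, d] :: 'a^4) $ 4 = d"
  unfolding vector_def by simp_all

text \<open>Laplace expansion along the first two rows into products of complementary minors, the
  form in which a determinant is a pairing of two bivectors.\<close>

lemma det_4:
  "det (A :: 'a::comm_ring_1^4^4) =
     (A$1$1 * A$2$2 - A$1$2 * A$2$1) * (A$3$3 * A$4$4 - A$3$4 * A$4$3)
   - (A$1$1 * A$2$3 - A$1$3 * A$2$1) * (A$3$2 * A$4$4 - A$3$4 * A$4$2)
   + (A$1$1 * A$2$4 - A$1$4 * A$2$1) * (A$3$2 * A$4$3 - A$3$3 * A$4$2)
   + (A$1$2 * A$2$3 - A$1$3 * A$2$2) * (A$3$1 * A$4$4 - A$3$4 * A$4$1)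
   - (A$1$2 * A$2$4 - A$1$4 * A$2$2) * (A$3$1 * A$4$3 - A$3$3 * A$4$1)
   + (A$1$3 * A$2$4 - A$1$4 * A$2$3) * (A$3$1 * A$4$2 - A$3$2 * A$4$1)"
proof -
  have f1234: "finite {2, 3, 4::4}" "1 \<notin> {2, 3, 4::4}" by auto
  have f234: "finite {3, 4::4}" "2 \<notin> {3, 4::4}" by auto
  have f34: "finite {4::4}" "3 \<notin> {4::4}" by auto
  show ?thesis
    unfolding det_def UNIV_4
    unfolding sum_over_permutations_insert[OF f1234] sum_over_permutations_insert[OF f234]
      sum_over_permutations_insert[OF f34] permutes_sing
    by (simp add: sign_swap_id permutation_swap_id sign_compose sign_id permutation_compose
        swap_id_eq algebra_simps)
qed

lemma bounded_bilinear_mink: "bounded_bilinear mink"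
  unfolding bilinear_conv_bounded_bilinear[symmetric] bilinear_def
  by (auto simp: mink_def algebra_simps intro!: linearI)

interpretation mink: bounded_bilinear mink
  by (rule bounded_bilinear_mink)

lemma mink_commute: "mink v w = mink w v"
  by (simp add: mink_def)

abbreviation det4 :: "minkowski \<Rightarrow> minkowski \<Rightarrow> minkowski \<Rightarrow> minkowski \<Rightarrow> real" where
  "det4 v w x y \<equiv> det (vector [v, w, x, y] :: real^4^4)"

text \<open>The Gram matrix is the product of the first matrix, the diagonal matrix of the metric
  and the transpose of the second; the minus sign is the determinant of the metric.\<close>

lemma det4_mult_det4:
  "det4 v1 v2 v3 v4 * det4 w1 w2 w3 w4 =
   - det (vector [vector [mink v1 w1, mink v1 w2, mink v1 w3, mink v1 w4],
                  vector [mink v2 w1, mink v2 w2, mink v2 w3, mink v2 w4],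
                  vector [mink v3 w1, mink v3 w2, mink v3 w3, mink v3 w4],
                  vector [mink v4 w1, mink v4 w2, mink v4 w3, mink v4 w4]] :: real^4^4)"
    (is "_ = - det ?G")
proof -
  let ?A = "vector [v1, v2, v3, v4] :: real^4^4" and ?B = "vector [w1, w2, w3, w4] :: real^4^4"
  let ?S = "vector [vector [-1, 0, 0, 0], vector [0, 1, 0, 0], vector [0, 0, 1, 0],
    vector [0, 0, 0, 1]] :: real^4^4"
  have "?G = (?A ** ?S) ** transpose ?B"
    by (simp add: vec_eq_iff forall_4 matrix_matrix_mult_def sum_4 transpose_def mink_def)
  then have "det ?G = det ?A * det ?S * det ?B" by (simp add: det_mul det_transpose)
  moreover have "det ?S = -1" by (simp add: det_4)
  ultimately show ?thesis by simp
qed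

text \<open>The complex structure of the bivectors is the Hodge star; in an electromagnetic reading,
  the three complex coordinates of a bivector are those of \<open>B + i E\<close>.\<close>
definition cwedge :: "minkowski \<Rightarrow> minkowski \<Rightarrow> complex^3" where
  "cwedge v w = vector
     [Complex (v$3 * w$4 - v$4 * w$3) (v$1 * w$2 - v$2 * w$1),
      Complex (v$4 * w$2 - v$2 * w$4) (v$1 * w$3 - v$3 * w$1),
      Complex (v$2 * w$3 - v$3 * w$2) (v$1 * w$4 - v$4 * w$1)]"

text \<open>Complex bilinear and not Hermitian, so isotropic vectors exist.\<close>

definition cdot :: "complex^3 \<Rightarrow> complex^3 \<Rightarrow> complex" where
  "cdot z w = z$1 * w$1 + z$2 * w$2 + z$3 * w$3"

lemma bounded_bilinear_cwedge: "bounded_bilinear cwedge"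
  unfolding bilinear_conv_bounded_bilinear[symmetric] bilinear_def
  by (auto simp: cwedge_def vec_eq_iff forall_3 complex_eq_iff algebra_simps intro!: linearI)

interpretation cwedge: bounded_bilinear cwedge
  by (rule bounded_bilinear_cwedge)

lemma bounded_bilinear_cdot: "bounded_bilinear cdot"
  unfolding bilinear_conv_bounded_bilinear[symmetric] bilinear_def
  by (auto simp: cdot_def complex_eq_iff algebra_simps intro!: linearI)

interpretation cdot: bounded_bilinear cdot
  by (rule bounded_bilinear_cdot)

lemma cdot_commute: "cdot z w = cdot w z"
  by (simp add: cdot_def mult.commute)

text \<open>One complex number carries both invariants of a pair of bivectors: the real part is
  their scalar product, the imaginary part the volume of their exterior product. The volume vanishes
  on repeated vectors, so an orthonormal pair gives a point of the complex sphere.\<close>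

lemma cdot_cwedge:
  "cdot (cwedge v w) (cwedge x y) =
     Complex (mink v x * mink w y - mink v y * mink w x) (det4 v w x y)"
  by (simp add: cdot_def cwedge_def complex_eq_iff det_4 mink_def algebra_simps)

lemma det4_repeated [simp]:
  "det4 v v x y = 0" "det4 v x v y = 0" "det4 v x y v = 0"
  "det4 x v v y = 0" "det4 x v y v = 0" "det4 x y v v = 0"
  by (simp_all add: det_4 algebra_simps)

lemma cwedge_self [simp]: "cwedge v v = 0"
  by (simp add: cwedge_def vec_eq_iff forall_3 complex_eq_iff)

lemma cwedge_swap: "cwedge v w = - cwedge w v"
  by (simp add: cwedge_def vec_eq_iff forall_3 complex_eq_iff)

text \<open>Since the squares do not vanish, the rows \<open>a\<close>, \<open>b\<close>,
  \<open>c\<close> divided by their squares and transposed give an inverse of the matrix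
  \<open>?M\<close>; the last three hypotheses say that \<open>?M\<close> kills
  \<open>x\<close>.\<close>

lemma cdot_orthogonal_basis:
  assumes "cdot a a \<noteq> 0" "cdot b b \<noteq> 0" "cdot c c \<noteq> 0"
    and "cdot a b = 0" "cdot a c = 0" "cdot b c = 0"
    and "cdot a x = 0" "cdot b x = 0" "cdot c x = 0"
  shows "x = 0"
proof -
  let ?M = "vector [a, b, c] :: complex^3^3"
  let ?N = "transpose (vector [inverse (cdot a a) *s a, inverse (cdot b b) *s b,
    inverse (cdot c c) *s c] :: complex^3^3)"
  have sc: "cdot y (r *s z) = r * cdot y z" for y z r
    by (simp add: cdot_def algebra_simps)
  have row: "(\<Sum>k\<in>UNIV. y $ k * z $ k) = cdot y z" for y z :: "complex^3"
    by (simp add: cdot_def sum_3)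
  have "?M ** ?N = mat 1"
    using assms
    by (simp add: vec_eq_iff forall_3 matrix_matrix_mult_def transpose_def
        row[of _ "_ *s _", simplified] mat_def sc cdot_commute)
  then have NM: "?N ** ?M = mat 1" using matrix_left_right_inverse by blast
  have "?M *v x = 0"
    using assms by (simp add: vec_eq_iff forall_3 matrix_vector_mult_def row)
  then have "?N *v (?M *v x) = 0" by simp
  then show ?thesis by (simp add: matrix_vector_mul_assoc NM)
qed

text \<open>On \<open>wedge v w\<close> this is \<open>- \<i>\<close> times
  \<open>cwedge v w\<close>. The factor is the Hodge star, so the wedge of the two normals is sent
  to the \<open>cwedge\<close> of the two tangent vectors. The map forgets the dependent entries of
  a matrix; \<open>of_complex3\<close> restores the skew-symmetric one.\<close>

definition to_complex3 :: "bivector \<Rightarrow> complex^3" where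
  "to_complex3 \<omega> = vector
     [Complex (\<omega>$1$2) (- \<omega>$3$4), Complex (\<omega>$1$3) (- \<omega>$4$2), Complex (\<omega>$1$4) (- \<omega>$2$3)]"

definition of_complex3 :: "complex^3 \<Rightarrow> bivector" where
  "of_complex3 z = vector
     [vector [0, Re (z$1), Re (z$2), Re (z$3)],
      vector [- Re (z$1), 0, - Im (z$3), Im (z$2)],
      vector [- Re (z$2), Im (z$3), 0, - Im (z$1)],
      vector [- Re (z$3), - Im (z$2), Im (z$1), 0]]"

lemma bounded_linear_to_complex3: "bounded_linear to_complex3"
  unfolding linear_conv_bounded_linear[symmetric]
  by (auto simp: to_complex3_def vec_eq_iff forall_3 complex_eq_iff intro!: linearI)

lemma bounded_linear_of_complex3: "bounded_linear of_complex3"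
  unfolding linear_conv_bounded_linear[symmetric]
  by (auto simp: of_complex3_def vec_eq_iff forall_4 intro!: linearI)

lemma to_complex3_of_complex3 [simp]: "to_complex3 (of_complex3 z) = z"
  by (simp add: to_complex3_def of_complex3_def vec_eq_iff forall_3 complex_eq_iff)

lemma of_complex3_to_complex3_wedge [simp]: "of_complex3 (to_complex3 (wedge v w)) = wedge v w"
  by (simp add: to_complex3_def of_complex3_def wedge_def vec_eq_iff forall_4)

text \<open>The Gram matrix of \<open>e1, e2, x, y\<close> against the frame shows that \<open>det (e1, e2, x, y)\<close> is minus the
  pairing of \<open>x \<and> y\<close> with \<open>e3 \<and> e4\<close>; then \<open>x\<close> and \<open>y\<close> run through the coordinate axes.\<close>
lemma to_complex3_wedge_normal:
  assumes "mink e1 e1 = 1" "mink e2 e2 = 1" "mink e1 e2 = 0"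
    and "mink e3 e1 = 0" "mink e3 e2 = 0" "mink e4 e1 = 0" "mink e4 e2 = 0"
    and "\<bar>mink e3 e3\<bar> = 1" "\<bar>mink e4 e4\<bar> = 1" "mink e3 e4 = 0"
    and pos: "det4 e1 e2 e3 e4 > 0"
  shows "to_complex3 (wedge e3 e4) = cwedge e1 e2"
proof -
  note orth = assms(1-7,10) mink_commute[of e2 e1] mink_commute[of e1 e3] mink_commute[of e2 e3]
    mink_commute[of e1 e4] mink_commute[of e2 e4] mink_commute[of e4 e3]
  have "det4 e1 e2 e3 e4 * det4 e1 e2 e3 e4 = - (mink e3 e3 * mink e4 e4)"
    by (subst det4_mult_det4, simp add: orth det_4)
  moreover have "mink e3 e3 * mink e4 e4 = 1 \<or> mink e3 e3 * mink e4 e4 = -1"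
    using assms(8,9) by (auto simp: abs_if split: if_splits)
  \<comment> \<open>The square of the determinant is minus the product of the two normal signs. As
    it cannot be negative, the signs are opposite, whichever normal is time-like.\<close>
  ultimately have "det4 e1 e2 e3 e4 * det4 e1 e2 e3 e4 = 1"
    using zero_le_square[of "det4 e1 e2 e3 e4"] by linarith
  then have det1: "det4 e1 e2 e3 e4 = 1" using pos by (simp add: square_eq_1_iff)
  have *: "det4 e1 e2 x y = - (mink x e3 * mink y e4 - mink x e4 * mink y e3)" for x y
  proof -
    have "det4 e1 e2 x y * det4 e1 e2 e3 e4 = - (mink x e3 * mink y e4 - mink x e4 * mink y e3)"
      by (subst det4_mult_det4, simp add: orth det_4)
    then show ?thesis by (simp add: det1)
  qed
  have "wedge e3 e4 $ 1 $ 2 = e1$3 * e2$4 - e1$4 * e2$3"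
       "wedge e3 e4 $ 1 $ 3 = e1$4 * e2$2 - e1$2 * e2$4"
       "wedge e3 e4 $ 1 $ 4 = e1$2 * e2$3 - e1$3 * e2$2"
       "wedge e3 e4 $ 3 $ 4 = - (e1$1 * e2$2 - e1$2 * e2$1)"
       "wedge e3 e4 $ 4 $ 2 = - (e1$1 * e2$3 - e1$3 * e2$1)"
       "wedge e3 e4 $ 2 $ 3 = - (e1$1 * e2$4 - e1$4 * e2$1)"
    using *[of "axis 1 1" "axis 2 1"] *[of "axis 1 1" "axis 3 1"] *[of "axis 1 1" "axis 4 1"]
      *[of "axis 3 1" "axis 4 1"] *[of "axis 4 1" "axis 2 1"] *[of "axis 2 1" "axis 3 1"]
    by (simp_all add: det_4 axis_def wedge_def mink_def algebra_simps)
  then show ?thesis by (simp add: to_complex3_def cwedge_def vec_eq_iff forall_3)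
qed

text \<open>The time-like normal \<open>e4\<close> is the normalized normal part of the time axis, and \<open>e3\<close> is the
  cross product of \<open>e1, e2, e4\<close>.\<close>
lemma exists_normal_frame:
  assumes e: "mink e1 e1 = 1" "mink e2 e2 = 1" "mink e1 e2 = 0"
  obtains e3 e4 where "mink e3 e1 = 0" "mink e3 e2 = 0" "mink e4 e1 = 0" "mink e4 e2 = 0"
    "mink e3 e3 = 1" "mink e4 e4 = -1" "mink e3 e4 = 0" "det4 e1 e2 e3 e4 > 0"
proof -
  define t where "t = (axis 1 1 :: minkowski)"
  define m where "m = t - mink t e1 *\<^sub>R e1 - mink t e2 *\<^sub>R e2"
  have e': "mink e2 e1 = 0" using e mink_commute by simp
  have m1: "mink m e1 = 0" "mink m e2 = 0"
    by (simp_all add: m_def mink.diff_left mink.scaleR_left e e')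
  have "mink t t = -1" by (simp add: t_def mink_def axis_def)
  then have "mink m m = -1 - (mink t e1)\<^sup>2 - (mink t e2)\<^sup>2"
    by (simp add: m_def mink.diff_left mink.diff_right mink.scaleR_left mink.scaleR_right e e'
        mink_commute[of e1 t] mink_commute[of e2 t] power2_eq_square)
  then have neg: "mink m m < 0" using zero_le_power2[of "mink t e1"] zero_le_power2[of "mink t e2"]
    by linarith
  define e4 where "e4 = (1 / sqrt (- mink m m)) *\<^sub>R m"
  have e4: "mink e4 e4 = -1" "mink e4 e1 = 0" "mink e4 e2 = 0"
    using neg m1 by (simp_all add: e4_def mink.scaleR_left mink.scaleR_right flip: real_sqrt_mult)
  have e4': "mink e1 e4 = 0" "mink e2 e4 = 0" using e4 mink_commute by simp_all
  \<comment> \<open>The sign of the first component compensates the negative coefficient of the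
    metric, so that \<open>mink x e3\<close> becomes the determinant with \<open>x\<close> in the
    third place.\<close>
  define e3 :: minkowski where "e3 = vector [- det4 e1 e2 (axis 1 1) e4, det4 e1 e2 (axis 2 1) e4,
    det4 e1 e2 (axis 3 1) e4, det4 e1 e2 (axis 4 1) e4]"
  have e3: "mink x e3 = det4 e1 e2 x e4" for x
    by (simp add: e3_def mink_def det_4 axis_def algebra_simps)
  have zero: "mink e1 e3 = 0" "mink e2 e3 = 0" "mink e4 e3 = 0"
    unfolding e3 by (simp_all add: det_4 algebra_simps)
  have sq: "mink x e3 * mink x e3 = mink x x - mink x e1 * mink x e1 - mink x e2 * mink x e2
    + mink x e4 * mink x e4" for x
  proof -
    have "mink x e3 * mink x e3 = det4 e1 e2 x e4 * det4 e1 e2 x e4" by (simp add: e3)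
    also have "\<dots> = mink x x - mink x e1 * mink x e1 - mink x e2 * mink x e2 + mink x e4 * mink x e4"
      by (subst det4_mult_det4,
          simp add: det_4 e e' e4 e4' mink_commute[of e1 x] mink_commute[of e2 x] mink_commute[of e4 x])
    finally show ?thesis .
  qed
  \<comment> \<open>Both sides of \<open>sq\<close> are summed over the coordinate axes with the
    signs of the metric. This is a trace: the term \<open>mink x x\<close> contributes the dimension
    4, and each of the other terms the square of a frame vector.\<close>
  have "mink e3 e3 = 4 - mink e1 e1 - mink e2 e2 + mink e4 e4"
    using sq[of "axis 1 1"] sq[of "axis 2 1"] sq[of "axis 3 1"] sq[of "axis 4 1"]
    by (simp add: mink_def axis_def)
  then have "mink e3 e3 = 1" by (simp add: e e4)
  then show thesis using that[of e3 e4] e3[of e3] zero e4 by (simp add: mink_commute)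
qed

section \<open>Space-like immersions of plane domains\<close>

lemma plane_basis:
  assumes "det (vector [a, b] :: real^2^2) \<noteq> 0"
  obtains p q where "v = p *\<^sub>R a + q *\<^sub>R (b :: real^2)"
proof -
  let ?d = "det (vector [a, b] :: real^2^2)"
  have "v = (det (vector [v, b] :: real^2^2) / ?d) *\<^sub>R a + (det (vector [a, v] :: real^2^2) / ?d) *\<^sub>R b"
    using assms by (simp add: vec_eq_iff forall_2 det_2 divide_simps) (simp add: algebra_simps)
  then show thesis by (rule that)
qed

locale spacelike_chart =
  fixes V :: "(real^2) set" and F :: "real^2 \<Rightarrow> minkowski"
  assumes open_V: "open V"
    and smooth_F: "smooth_on V F"
    and spacelike: "\<And>x a. x \<in> V \<Longrightarrow> a \<noteq> 0 \<Longrightarrow> mink (pd a F x) (pd a F x) > 0"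
begin

text \<open>The vectors live in the parameter plane and are orthonormal for the metric induced at
  this one point. Kept constant, they serve as directions of iterated derivatives.\<close>

definition orthonormal_at :: "real^2 \<Rightarrow> real^2 \<Rightarrow> real^2 \<Rightarrow> bool" where
  "orthonormal_at x a b \<longleftrightarrow> mink (pd a F x) (pd a F x) = 1 \<and> mink (pd b F x) (pd b F x) = 1 \<and>
     mink (pd a F x) (pd b F x) = 0"

definition gram :: "real^2 \<Rightarrow> real^2 \<Rightarrow> real^2 \<Rightarrow> real" where
  "gram a b x = mink (pd a F x) (pd a F x) * mink (pd b F x) (pd b F x)
     - mink (pd a F x) (pd b F x) * mink (pd a F x) (pd b F x)"

lemma linear_F: "x \<in> V \<Longrightarrow> linear (\<lambda>v. pd v F x)"
  by (rule linear_pd[OF smooth_on_differentiable[OF smooth_F]])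

lemma pd_F_add: "x \<in> V \<Longrightarrow> pd (v + w) F x = pd v F x + pd w F x"
  using linear_add[OF linear_F] .

lemma pd_F_diff: "x \<in> V \<Longrightarrow> pd (v - w) F x = pd v F x - pd w F x"
  using linear_diff[OF linear_F] .

lemma pd_F_scaleR: "x \<in> V \<Longrightarrow> pd (r *\<^sub>R v) F x = r *\<^sub>R pd v F x"
  using linear_cmul[OF linear_F] .

lemma pd_F_eq_0_iff: "x \<in> V \<Longrightarrow> pd v F x = 0 \<longleftrightarrow> v = 0"
  using spacelike[of x v] linear_0[OF linear_F] mink.zero_left by fastforce

lemma pd_F_cancel: "x \<in> V \<Longrightarrow> pd v F x = pd w F x \<longleftrightarrow> v = w"
  using pd_F_eq_0_iff[of x "v - w"] by (simp add: pd_F_diff)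

text \<open>The usual Gram-Schmidt vector multiplied by the squared length of the first one, which
  avoids a division.\<close>

definition gram_schmidt :: "real^2 \<Rightarrow> real^2 \<Rightarrow> real^2 \<Rightarrow> real^2" where
  "gram_schmidt a b x = mink (pd a F x) (pd a F x) *\<^sub>R b - mink (pd a F x) (pd b F x) *\<^sub>R a"

lemma mink_gram_schmidt:
  assumes x: "x \<in> V"
  shows "mink (pd a F x) (pd (gram_schmidt a b x) F x) = 0"
    and "mink (pd (gram_schmidt a b x) F x) (pd (gram_schmidt a b x) F x) =
      mink (pd a F x) (pd a F x) * gram a b x"
  by (simp_all add: gram_schmidt_def gram_def pd_F_diff pd_F_scaleR x mink.diff_left
      mink.diff_right mink.scaleR_left mink.scaleR_right
      mink_commute[of "pd b F x" "pd a F x"] algebra_simps)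

text \<open>By \<open>mink_gram_schmidt\<close>, the Gram determinant is a positive multiple of the
  square of the Gram-Schmidt vector, which is nonzero and hence space-like.\<close>

lemma gram_pos:
  assumes x: "x \<in> V" and d: "det (vector [a, b] :: real^2^2) \<noteq> 0"
  shows "gram a b x > 0"
proof -
  have a: "a \<noteq> 0" using d by (auto simp: det_2)
  have "det (vector [a, gram_schmidt a b x] :: real^2^2) =
      mink (pd a F x) (pd a F x) * det (vector [a, b] :: real^2^2)"
    by (simp add: gram_schmidt_def det_2 algebra_simps)
  then have "det (vector [a, gram_schmidt a b x] :: real^2^2) \<noteq> 0"
    using d spacelike[OF x a] by simp
  moreover have "det (vector [a, 0] :: real^2^2) = 0" by (simp add: det_2)
  ultimately have "gram_schmidt a b x \<noteq> 0" by metis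
  from spacelike[OF x this] show ?thesis
    using spacelike[OF x a] by (simp add: mink_gram_schmidt x zero_less_mult_iff)
qed

definition frame1 :: "real^2 \<Rightarrow> real^2" where
  "frame1 x = (mink (pd (axis 1 1) F x) (pd (axis 1 1) F x)) powr (-1/2) *\<^sub>R axis 1 1"

definition frame2 :: "real^2 \<Rightarrow> real^2" where
  "frame2 x = (mink (pd (axis 1 1) F x) (pd (axis 1 1) F x) * gram (axis 1 1) (axis 2 1) x) powr (-1/2) *\<^sub>R
     gram_schmidt (axis 1 1) (axis 2 1) x"

lemma det_axis: "det (vector [axis 1 1, axis 2 1] :: real^2^2) = 1"
  by (simp add: det_2 axis_def)

lemma axis_nonzero: "(axis 1 1 :: real^2) \<noteq> 0"
  by (simp add: axis_eq_0_iff)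

lemma frame_pos:
  assumes x: "x \<in> V"
  shows "mink (pd (axis 1 1) F x) (pd (axis 1 1) F x) > 0" "gram (axis 1 1) (axis 2 1) x > 0"
  using spacelike[OF x axis_nonzero] gram_pos[OF x] det_axis by simp_all

lemma frame:
  assumes x: "x \<in> V"
  shows "orthonormal_at x (frame1 x) (frame2 x)"
    and "det (vector [frame1 x, frame2 x] :: real^2^2) > 0"
proof -
  note pos = frame_pos[OF x]
  have sq: "r powr (-1/2) * (r powr (-1/2) * r) = 1" if "r > 0" for r :: real
    using that by (simp add: powr_minus powr_half_sqrt field_simps)
  show "orthonormal_at x (frame1 x) (frame2 x)"
    using sq[OF pos(1)] sq[OF mult_pos_pos[OF pos]]
    by (simp add: orthonormal_at_def frame1_def frame2_def pd_F_scaleR x mink.scaleR_left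
        mink.scaleR_right mink_gram_schmidt)
  show "det (vector [frame1 x, frame2 x] :: real^2^2) > 0"
    using pos by (simp add: frame1_def frame2_def gram_schmidt_def det_2 axis_def)
qed

lemma smooth_mink:
  "smooth_on V f \<Longrightarrow> smooth_on V g \<Longrightarrow> smooth_on V (\<lambda>x. mink (f x) (g x))"
  by (rule smooth_on_bilinear[OF open_V bounded_bilinear_mink])

lemma smooth_pd_F: "smooth_on V (pd v F)"
  by (rule smooth_on_pd[OF smooth_F])

lemma smooth_gram: "smooth_on V (gram a b)"
  unfolding gram_def[abs_def]
  by (intro smooth_on_diff smooth_on_mult smooth_mink smooth_pd_F open_V)

lemma smooth_frame: "smooth_on V frame1" "smooth_on V frame2"
  unfolding frame1_def[abs_def] frame2_def[abs_def] gram_schmidt_def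
  by (intro smooth_on_diff smooth_on_mult smooth_mink smooth_pd_F smooth_on_const smooth_on_powr
      smooth_on_scaleR smooth_gram open_V mult_pos_pos frame_pos; assumption)+

lemma pd_mink:
  assumes "smooth_on V f" "smooth_on V g" "x \<in> V"
  shows "pd v (\<lambda>x. mink (f x) (g x)) x = mink (f x) (pd v g x) + mink (pd v f x) (g x)"
  using assms by (intro pd_bilinear[OF bounded_bilinear_mink] smooth_on_differentiable)

lemma pd_cdot:
  assumes "smooth_on V f" "smooth_on V g" "x \<in> V"
  shows "pd v (\<lambda>x. cdot (f x) (g x)) x = cdot (f x) (pd v g x) + cdot (pd v f x) (g x)"
  using assms by (intro pd_bilinear[OF bounded_bilinear_cdot] smooth_on_differentiable)

lemma tangent_expansion:
  assumes x: "x \<in> V" and o: "orthonormal_at x a b" and d: "det (vector [a, b] :: real^2^2) \<noteq> 0"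
  shows "pd c F x = mink (pd c F x) (pd a F x) *\<^sub>R pd a F x + mink (pd c F x) (pd b F x) *\<^sub>R pd b F x"
    and "c = mink (pd c F x) (pd a F x) *\<^sub>R a + mink (pd c F x) (pd b F x) *\<^sub>R b"
proof -
  obtain p q where c: "c = p *\<^sub>R a + q *\<^sub>R b" using plane_basis[OF d] by blast
  have "mink (pd c F x) (pd a F x) = p" "mink (pd c F x) (pd b F x) = q"
    using o by (simp_all add: c x pd_F_add pd_F_scaleR mink.add_left mink.scaleR_left
        orthonormal_at_def mink_commute[of "pd b F x" "pd a F x"])
  then show "c = mink (pd c F x) (pd a F x) *\<^sub>R a + mink (pd c F x) (pd b F x) *\<^sub>R b"
    using c by simp
  then have "pd c F x = pd (mink (pd c F x) (pd a F x) *\<^sub>R a + mink (pd c F x) (pd b F x) *\<^sub>R b) F x"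
    by simp
  then show "pd c F x = mink (pd c F x) (pd a F x) *\<^sub>R pd a F x + mink (pd c F x) (pd b F x) *\<^sub>R pd b F x"
    by (simp add: pd_F_add pd_F_scaleR x)
qed

text \<open>A change of basis multiplies both the wedge and the root of the Gram determinant by the
  determinant \<open>p * s - q * r\<close>, which is positive because both bases are positively
  oriented. The normalized wedge is thus common to all positive bases.\<close>

lemma cwedge_orthonormal:
  assumes x: "x \<in> V" and o: "orthonormal_at x a b"
    and d: "det (vector [a, b] :: real^2^2) > 0" and d': "det (vector [v, w] :: real^2^2) > 0"
  shows "cwedge (pd a F x) (pd b F x) = gram v w x powr (-1/2) *\<^sub>R cwedge (pd v F x) (pd w F x)"
proof -
  obtain p q where v: "v = p *\<^sub>R a + q *\<^sub>R b" using plane_basis[of a b v] d by auto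
  obtain r s where w: "w = r *\<^sub>R a + s *\<^sub>R b" using plane_basis[of a b w] d by auto
  have "det (vector [v, w] :: real^2^2) = (p * s - q * r) * det (vector [a, b] :: real^2^2)"
    by (simp add: v w det_2 algebra_simps)
  then have pos: "p * s - q * r > 0" using d d' by (simp add: zero_less_mult_iff)
  have "gram v w x = (p * s - q * r)\<^sup>2"
    using o mink_commute[of "pd b F x" "pd a F x"]
    by (simp add: gram_def v w x pd_F_add pd_F_scaleR mink.add_left mink.scaleR_left mink.add_right
        mink.scaleR_right orthonormal_at_def power2_eq_square algebra_simps)
  then have "gram v w x powr (-1/2) = 1 / (p * s - q * r)"
    using pos by (simp add: powr_minus powr_half_sqrt divide_simps flip: powr_minus_divide)
  moreover have "cwedge (pd v F x) (pd w F x) = (p * s - q * r) *\<^sub>R cwedge (pd a F x) (pd b F x)"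
    using cwedge_swap[of "pd b F x" "pd a F x"]
    by (simp add: v w x pd_F_add pd_F_scaleR cwedge.add_left cwedge.scaleR_left cwedge.add_right
        cwedge.scaleR_right scaleR_diff_left algebra_simps)
  ultimately show ?thesis using pos by simp
qed

text \<open>Orthogonal projection onto the tangent plane, read off in the parameter plane. It is a
  linear left inverse of the differential of \<open>F\<close>, and the smooth frame makes it depend
  smoothly on the point.\<close>

definition tangent_coord :: "real^2 \<Rightarrow> minkowski \<Rightarrow> real^2" where
  "tangent_coord x w = mink w (pd (frame1 x) F x) *\<^sub>R frame1 x + mink w (pd (frame2 x) F x) *\<^sub>R frame2 x"

lemma linear_tangent_coord: "linear (tangent_coord x)"
  by (rule linearI) (simp_all add: tangent_coord_def mink.add_left mink.scaleR_left
      scaleR_add_left scaleR_add_right)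

lemma tangent_coord_pd:
  assumes x: "x \<in> V" shows "tangent_coord x (pd c F x) = c"
  using tangent_expansion(2)[OF x frame(1)[OF x], of c] frame(2)[OF x]
  by (simp add: tangent_coord_def)

lemma mink_diff_tangent_coord:
  assumes x: "x \<in> V" shows "mink (w - pd (tangent_coord x w) F x) (pd c F x) = 0"
proof -
  have o: "mink (pd (frame1 x) F x) (pd (frame1 x) F x) = 1" "mink (pd (frame2 x) F x) (pd (frame2 x) F x) = 1"
    "mink (pd (frame1 x) F x) (pd (frame2 x) F x) = 0" "mink (pd (frame2 x) F x) (pd (frame1 x) F x) = 0"
    using frame(1)[OF x] by (auto simp: orthonormal_at_def mink_commute)
  obtain p q where c: "c = p *\<^sub>R frame1 x + q *\<^sub>R frame2 x"
    using plane_basis[of "frame1 x" "frame2 x" c] frame(2)[OF x] by auto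
  show ?thesis
    by (simp add: c tangent_coord_def pd_F_add pd_F_scaleR x mink.diff_left mink.add_left
        mink.add_right mink.scaleR_left mink.scaleR_right o)
qed

lemma orthonormal_at_det:
  assumes x: "x \<in> V" and o: "orthonormal_at x a b"
  shows "det (vector [a, b] :: real^2^2) \<noteq> 0"
proof
  assume d: "det (vector [a, b] :: real^2^2) = 0"
  \<comment> \<open>Linear dependence in a form that needs no case distinction. Taking the product
    with the image of \<open>b\<close> turns it into \<open>a $ i = 0\<close>.\<close>
  have "a $ i *\<^sub>R b = b $ i *\<^sub>R a" for i
    using d exhaust_2[of i] by (auto simp: det_2 vec_eq_iff forall_2 mult.commute)
  then have "mink (pd (a $ i *\<^sub>R b) F x) (pd b F x) = mink (pd (b $ i *\<^sub>R a) F x) (pd b F x)" for i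
    by simp
  then have "a $ i = 0" for i
    using o by (simp add: pd_F_scaleR x mink.scaleR_left orthonormal_at_def)
  then have "a = 0" by (simp add: vec_eq_iff)
  then show False
    using o linear_0[OF linear_F[OF x]] by (simp add: orthonormal_at_def mink.zero_left)
qed

text \<open>The change between two orthonormal bases is an orthogonal matrix, whose columns are
  orthonormal as well.\<close>
lemma trace_orthonormal:
  fixes B :: "real^2 \<Rightarrow> real^2 \<Rightarrow> 'b::real_vector"
  assumes x: "x \<in> V" and o: "orthonormal_at x a b" and o': "orthonormal_at x a' b'"
    and lin: "\<And>v. linear (B v)" and sym: "\<And>v w. B v w = B w v"
  shows "B a' a' + B b' b' = B a a + B b b"
proof -
  have dd: "det (vector [a, b] :: real^2^2) \<noteq> 0" by (rule orthonormal_at_det[OF x o])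
  obtain p q where a': "a' = p *\<^sub>R a + q *\<^sub>R b" using plane_basis[OF dd] by blast
  obtain r s where b': "b' = r *\<^sub>R a + s *\<^sub>R b" using plane_basis[OF dd] by blast
  have "mink (pd a' F x) (pd a' F x) = p * p + q * q" "mink (pd b' F x) (pd b' F x) = r * r + s * s"
    "mink (pd a' F x) (pd b' F x) = p * r + q * s"
    using o mink_commute[of "pd b F x" "pd a F x"]
    by (simp_all add: a' b' pd_F_add pd_F_scaleR x mink.add_left mink.add_right mink.scaleR_left
        mink.scaleR_right orthonormal_at_def)
  then have rows: "p * p + q * q = 1" "r * r + s * s = 1" "p * r + q * s = 0"
    using o' by (auto simp: orthonormal_at_def)
  have cols: "p * p + r * r = 1" "q * q + s * s = 1" "p * q + r * s = 0"
  proof -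
    let ?M = "vector [vector [p, q], vector [r, s]] :: real^2^2"
    have "?M ** transpose ?M = mat 1"
      using rows by (simp add: vec_eq_iff forall_2 matrix_matrix_mult_def transpose_def sum_2 mat_def
          mult.commute)
    then have "transpose ?M ** ?M = mat 1" using matrix_left_right_inverse by blast
    then show "p * p + r * r = 1" "q * q + s * s = 1" "p * q + r * s = 0"
      by (simp_all add: vec_eq_iff forall_2 matrix_matrix_mult_def transpose_def sum_2 mat_def)
  qed
  have add: "B u (v + w) = B u v + B u w" "B (v + w) u = B v u + B w u"
    and scale: "B u (t *\<^sub>R v) = t *\<^sub>R B u v" "B (t *\<^sub>R v) u = t *\<^sub>R B v u" for u v w t
    using linear_add[OF lin] linear_cmul[OF lin] sym by metis+
  have "B a' a' + B b' b' = (p * p + r * r) *\<^sub>R B a a + (q * q + s * s) *\<^sub>R B b b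
      + (2 * (p * q + r * s)) *\<^sub>R B a b"
    by (simp add: a' b' add scale sym[of b a] algebra_simps scaleR_2 flip: scaleR_add_left)
      (simp add: algebra_simps flip: scaleR_2)
  then show ?thesis unfolding cols by simp
qed

lemma smooth_tangent_coord:
  assumes "open U" "U \<subseteq> V" "smooth_on U e"
  shows "smooth_on U (\<lambda>y. tangent_coord y (e y))"
proof -
  have fr: "smooth_on U frame1" "smooth_on U frame2" and F: "smooth_on U F"
    using smooth_frame smooth_F assms(2) smooth_on_subset by blast+
  show ?thesis
    unfolding tangent_coord_def
    by (intro smooth_on_add smooth_on_scaleR smooth_on_bilinear[OF _ bounded_bilinear_mink]
        smooth_on_pd_field assms(1,3) fr F)
qed

end

section \<open>The Gauss map of a maximal immersion\<close>

text \<open>\<open>n_eq\<close> covers all positive bases because it is differentiated with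
  \<open>a\<close> and \<open>b\<close> fixed, and these do not stay orthonormal nearby. In
  \<open>laplace\<close>, the first equation says that the mean curvature vanishes: the sum of
  second derivatives is tangent. Its coordinate vector \<open>c\<close> is also the Christoffel
  correction of the Laplacian, whose sign convention explains \<open>- lam\<close>.\<close>

locale maximal_chart = spacelike_chart +
  fixes n :: "real^2 \<Rightarrow> complex^3" and lam :: real
  assumes smooth_n: "smooth_on V n"
    and n_eq: "\<And>x a b. x \<in> V \<Longrightarrow> det (vector [a, b] :: real^2^2) > 0 \<Longrightarrow>
      n x = gram a b x powr (-1/2) *\<^sub>R cwedge (pd a F x) (pd b F x)"
    and laplace: "\<And>x a b. x \<in> V \<Longrightarrow> det (vector [a, b] :: real^2^2) > 0 \<Longrightarrow> orthonormal_at x a b \<Longrightarrow>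
      \<exists>c. pd c F x = pd a (pd a F) x + pd b (pd b F) x \<and>
          pd a (pd a n) x + pd b (pd b n) x - pd c n x = - lam *\<^sub>R n x"
begin

section \<open>Derivatives of the Gauss map\<close>

lemma cdot_n_n: "x \<in> V \<Longrightarrow> cdot (n x) (n x) = 1"
proof -
  assume x: "x \<in> V"
  note o = frame[OF x]
  have "gram (frame1 x) (frame2 x) x = 1"
    using o(1) by (simp add: gram_def orthonormal_at_def)
  then have "n x = cwedge (pd (frame1 x) F x) (pd (frame2 x) F x)"
    by (simp add: n_eq[OF x o(2)])
  then show "cdot (n x) (n x) = 1"
    using o(1) by (simp add: cdot_cwedge orthonormal_at_def complex_eq_iff)
qed

lemma cdot_n_pd: assumes x: "x \<in> V" shows "cdot (n x) (pd v n x) = 0"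
proof -
  have "pd v (\<lambda>x. cdot (n x) (n x)) x = pd v (\<lambda>x. 1) x"
    by (rule pd_cong_open[OF open_V x]) (rule cdot_n_n)
  also have "\<dots> = 0" by (rule pd_eqI) (rule has_derivative_const)
  finally show ?thesis using pd_cdot[OF smooth_n smooth_n x, of v] cdot_commute[of "pd v n x"] by simp
qed

lemma cdot_n_pd_pd:
  assumes x: "x \<in> V" shows "cdot (n x) (pd w (pd v n) x) = - cdot (pd v n x) (pd w n x)"
proof -
  have "pd w (\<lambda>x. cdot (n x) (pd v n x)) x = pd w (\<lambda>x. 0) x"
    by (rule pd_cong_open[OF open_V x]) (rule cdot_n_pd)
  also have "\<dots> = 0" by (rule pd_eqI) (rule has_derivative_const)
  finally show ?thesis
    using pd_cdot[OF smooth_n smooth_on_pd[OF smooth_n] x, of w v] cdot_commute[of "pd w n x"]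
    by (simp add: add_eq_0_iff2 add.commute)
qed

lemma pd_n_add: "x \<in> V \<Longrightarrow> pd (v + w) n x = pd v n x + pd w n x"
  using linear_add[OF linear_pd[OF smooth_on_differentiable[OF smooth_n]]] .

lemma pd_n_scaleR: "x \<in> V \<Longrightarrow> pd (r *\<^sub>R v) n x = r *\<^sub>R pd v n x"
  using linear_cmul[OF linear_pd[OF smooth_on_differentiable[OF smooth_n]]] .

text \<open>The subtracted term comes from the factor \<open>gram a b x powr (-1/2)\<close>, whose
  derivative at the Gram determinant 1 is minus half that of the determinant. It removes the
  component along the tangent bivector that varying lengths would produce.\<close>

lemma pd_n_orthonormal:
  assumes x: "x \<in> V" and d: "det (vector [a, b] :: real^2^2) > 0" and o: "orthonormal_at x a b"
  shows "pd v n x = cwedge (pd v (pd a F) x) (pd b F x) + cwedge (pd a F x) (pd v (pd b F) x)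
    - (mink (pd v (pd a F) x) (pd a F x) + mink (pd v (pd b F) x) (pd b F x)) *\<^sub>R
      cwedge (pd a F x) (pd b F x)"
proof -
  have gr: "gram a b x = 1" using o by (simp add: gram_def orthonormal_at_def)
  have "pd v (gram a b) x = 2 * (mink (pd v (pd a F) x) (pd a F x) + mink (pd v (pd b F) x) (pd b F x))"
  proof -
    have "pd v (gram a b) x =
      (mink (pd a F x) (pd a F x) * pd v (\<lambda>x. mink (pd b F x) (pd b F x)) x
       + pd v (\<lambda>x. mink (pd a F x) (pd a F x)) x * mink (pd b F x) (pd b F x))
      - (mink (pd a F x) (pd b F x) * pd v (\<lambda>x. mink (pd a F x) (pd b F x)) x
       + pd v (\<lambda>x. mink (pd a F x) (pd b F x)) x * mink (pd a F x) (pd b F x))"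
      unfolding gram_def[abs_def]
      by (subst pd_diff pd_bilinear[OF bounded_bilinear_mult];
          (rule smooth_on_differentiable[OF _ x])?;
          (intro smooth_on_mult smooth_mink smooth_pd_F open_V)?)+ simp
    then show ?thesis using o
      by (simp add: orthonormal_at_def pd_mink smooth_pd_F x
          mink_commute[of "pd a F x" "pd v (pd a F) x"] mink_commute[of "pd b F x" "pd v (pd b F) x"])
  qed
  moreover have w: "pd v (\<lambda>y. gram a b y powr (-1/2)) x = - (1/2) * pd v (gram a b) x"
    using pd_eqI[OF has_derivative_powr_const[OF smooth_on_differentiable[OF smooth_gram x]],
        of a b v "-1/2"] gr by simp
  moreover have "pd v n x = pd v (\<lambda>y. gram a b y powr (-1/2) *\<^sub>R cwedge (pd a F y) (pd b F y)) x"
    by (rule pd_cong_open[OF open_V x]) (rule n_eq[OF _ d])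
  moreover have "\<dots> = gram a b x powr (-1/2) *\<^sub>R pd v (\<lambda>y. cwedge (pd a F y) (pd b F y)) x
      + pd v (\<lambda>y. gram a b y powr (-1/2)) x *\<^sub>R cwedge (pd a F x) (pd b F x)"
  proof (rule pd_bilinear[OF bounded_bilinear_scaleR])
    show "(\<lambda>y. gram a b y powr (-1/2)) differentiable (at x)"
      using d by (intro smooth_on_differentiable[OF _ x] smooth_on_powr open_V smooth_gram gram_pos) auto
    show "(\<lambda>y. cwedge (pd a F y) (pd b F y)) differentiable (at x)"
      by (intro smooth_on_differentiable[OF _ x] smooth_pd_F
          smooth_on_bilinear[OF open_V bounded_bilinear_cwedge])
  qed
  moreover have "pd v (\<lambda>y. cwedge (pd a F y) (pd b F y)) x =
      cwedge (pd a F x) (pd v (pd b F) x) + cwedge (pd v (pd a F) x) (pd b F x)"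
    by (intro pd_bilinear[OF bounded_bilinear_cwedge] smooth_on_differentiable[OF _ x] smooth_pd_F)
  ultimately show ?thesis unfolding w by (simp add: gr algebra_simps)
qed

definition normal_part :: "real^2 \<Rightarrow> real^2 \<Rightarrow> real^2 \<Rightarrow> minkowski \<Rightarrow> minkowski" where
  "normal_part x a b w = w - mink w (pd a F x) *\<^sub>R pd a F x - mink w (pd b F x) *\<^sub>R pd b F x"

text \<open>Vanishing mean curvature leaves only \<open>\<alpha>\<close> and \<open>\<beta>\<close>
  of the second fundamental form. The derivatives of \<open>n\<close> become
  \<open>cwedge \<alpha> e2 + cwedge e1 \<beta>\<close> and
  \<open>cwedge \<beta> e2 - cwedge e1 \<alpha>\<close>; the second arises from the first by
  replacing the pair \<open>(\<alpha>, \<beta>)\<close> with \<open>(\<beta>, - \<alpha>)\<close>.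
  Expanding the products shows that they are orthogonal with equal squares.\<close>

lemma conformal_at:
  assumes x: "x \<in> V" and d: "det (vector [a, b] :: real^2^2) > 0" and o: "orthonormal_at x a b"
  defines "\<alpha> \<equiv> normal_part x a b (pd a (pd a F) x)" and "\<beta> \<equiv> normal_part x a b (pd a (pd b F) x)"
  shows "normal_part x a b (pd b (pd b F) x) = - \<alpha>"
    and "mink \<alpha> \<alpha> + mink \<beta> \<beta> = lam / 2"
    and "cdot (pd a n x) (pd a n x) = lam / 2" "cdot (pd b n x) (pd b n x) = lam / 2"
    and "cdot (pd a n x) (pd b n x) = 0"
proof -
  define e1 e2 where "e1 = pd a F x" and "e2 = pd b F x"
  define f11 f12 f22 where "f11 = pd a (pd a F) x" and "f12 = pd a (pd b F) x" and "f22 = pd b (pd b F) x"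
  have f21: "pd b (pd a F) x = f12"
    unfolding f12_def by (rule pd_commute[OF open_V x smooth_F])
  have e: "mink e1 e1 = 1" "mink e2 e2 = 1" "mink e1 e2 = 0" "mink e2 e1 = 0"
    using o by (auto simp: orthonormal_at_def e1_def e2_def mink_commute)
  have \<alpha>: "\<alpha> = f11 - mink f11 e1 *\<^sub>R e1 - mink f11 e2 *\<^sub>R e2"
    and \<beta>: "\<beta> = f12 - mink f12 e1 *\<^sub>R e1 - mink f12 e2 *\<^sub>R e2"
    by (simp_all add: \<alpha>_def \<beta>_def normal_part_def e1_def e2_def f11_def f12_def)
  have perp: "mink \<alpha> e1 = 0" "mink \<alpha> e2 = 0" "mink \<beta> e1 = 0" "mink \<beta> e2 = 0"
    by (simp_all add: \<alpha> \<beta> mink.diff_left mink.scaleR_left e)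
  then have perp': "mink e1 \<alpha> = 0" "mink e2 \<alpha> = 0" "mink e1 \<beta> = 0" "mink e2 \<beta> = 0"
    by (simp_all add: mink_commute)
  obtain c where c: "pd c F x = f11 + f22"
    "pd a (pd a n) x + pd b (pd b n) x - pd c n x = - lam *\<^sub>R n x"
    using laplace[OF x d o] unfolding f11_def f22_def by blast
  have "f11 + f22 = mink (f11 + f22) e1 *\<^sub>R e1 + mink (f11 + f22) e2 *\<^sub>R e2"
    using tangent_expansion(1)[OF x o, of c] d c by (simp add: e1_def e2_def)
  then have f22: "f22 = mink f22 e1 *\<^sub>R e1 + mink f22 e2 *\<^sub>R e2 - \<alpha>"
    by (simp add: \<alpha> mink.add_left algebra_simps)
  moreover have "u = p + q - r \<Longrightarrow> u - p - q = - r" for u p q r :: minkowski by simp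
  ultimately show "normal_part x a b (pd b (pd b F) x) = - \<alpha>"
    unfolding normal_part_def e1_def[symmetric] e2_def[symmetric] f22_def[symmetric] by blast
  have f11: "f11 = mink f11 e1 *\<^sub>R e1 + mink f11 e2 *\<^sub>R e2 + \<alpha>"
    and f12: "f12 = mink f12 e1 *\<^sub>R e1 + mink f12 e2 *\<^sub>R e2 + \<beta>"
    by (simp_all add: \<alpha> \<beta>)
  have "cwedge f11 e2 = mink f11 e1 *\<^sub>R cwedge e1 e2 + cwedge \<alpha> e2"
    "cwedge e1 f12 = mink f12 e2 *\<^sub>R cwedge e1 e2 + cwedge e1 \<beta>"
    "cwedge f12 e2 = mink f12 e1 *\<^sub>R cwedge e1 e2 + cwedge \<beta> e2"
    "cwedge e1 f22 = mink f22 e2 *\<^sub>R cwedge e1 e2 - cwedge e1 \<alpha>"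
    by (subst f11 f12 f22; simp add: cwedge.add_left cwedge.add_right cwedge.diff_right
        cwedge.scaleR_left cwedge.scaleR_right)+
  then have n1: "pd a n x = cwedge \<alpha> e2 + cwedge e1 \<beta>"
    and n2: "pd b n x = cwedge \<beta> e2 - cwedge e1 \<alpha>"
    using pd_n_orthonormal[OF x d o, of a] pd_n_orthonormal[OF x d o, of b]
    by (simp_all add: f21 scaleR_add_left flip: e1_def e2_def f11_def f12_def f22_def)
  have swap: "det4 \<beta> e2 e1 \<alpha> = - det4 \<alpha> e2 e1 \<beta>" "det4 e1 \<beta> \<alpha> e2 = det4 \<alpha> e2 e1 \<beta>"
    "det4 e1 \<alpha> \<beta> e2 = - det4 \<alpha> e2 e1 \<beta>"
    by (simp_all add: det_4 algebra_simps)
  note ev = cdot.add_left cdot.add_right cdot.diff_left cdot.diff_right cdot_cwedge e perp perp' swap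
    mink_commute[of \<beta> \<alpha>] complex_eq_iff
  show ab: "cdot (pd a n x) (pd b n x) = 0" by (simp add: n1 n2 ev)
  have aa: "cdot (pd a n x) (pd a n x) = Complex (mink \<alpha> \<alpha> + mink \<beta> \<beta>) (2 * det4 \<alpha> e2 e1 \<beta>)"
    by (simp add: n1 ev)
  have bb: "cdot (pd b n x) (pd b n x) = cdot (pd a n x) (pd a n x)"
    unfolding aa by (simp add: n2 ev)
  \<comment> \<open>Pairing with \<open>n\<close> removes the first-order term along
    \<open>c\<close> and turns the second derivatives into minus the squares of the first ones, so
    \<open>lam\<close> is the sum of two equal squares.\<close>
  have "cdot (n x) (pd a (pd a n) x + pd b (pd b n) x - pd c n x) = - lam"
    unfolding c(2) by (simp add: cdot.scaleR_right cdot.minus_right cdot_n_n x scaleR_conv_of_real[where 'a=complex])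
  then have "cdot (pd a n x) (pd a n x) + cdot (pd b n x) (pd b n x) = lam"
    by (simp add: cdot.add_right cdot.diff_right cdot_n_pd_pd cdot_n_pd x algebra_simps add_eq_0_iff2)
  then show aa': "cdot (pd a n x) (pd a n x) = lam / 2" unfolding bb by (simp add: field_simps)
  then show "cdot (pd b n x) (pd b n x) = lam / 2" unfolding bb .
  show "mink \<alpha> \<alpha> + mink \<beta> \<beta> = lam / 2"
    using aa' unfolding aa by (simp add: complex_eq_iff)
qed

text \<open>Bilinear extension to constant directions at every point of the chart, so that the
  identity may be differentiated. In particular the complex metric induced by \<open>n\<close> has
  real values.\<close>

lemma conformal:
  assumes x: "x \<in> V"
  shows "cdot (pd v n x) (pd w n x) = lam / 2 * mink (pd v F x) (pd w F x)"
proof -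
  let ?a = "frame1 x" and ?b = "frame2 x"
  note o = frame[OF x]
  note cf = conformal_at[OF x o(2,1)]
  obtain p q where v: "v = p *\<^sub>R ?a + q *\<^sub>R ?b" using plane_basis[of ?a ?b v] o(2) by auto
  obtain r s where w: "w = r *\<^sub>R ?a + s *\<^sub>R ?b" using plane_basis[of ?a ?b w] o(2) by auto
  have "mink (pd v F x) (pd w F x) = p * r + q * s"
    using o(1) mink_commute[of "pd ?b F x" "pd ?a F x"]
    by (simp add: v w pd_F_add pd_F_scaleR x mink.add_left mink.add_right mink.scaleR_left
        mink.scaleR_right orthonormal_at_def)
  moreover have "cdot (pd v n x) (pd w n x) =
      of_real (p * r) * cdot (pd ?a n x) (pd ?a n x) + of_real (q * s) * cdot (pd ?b n x) (pd ?b n x)"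
    using cf(5) cdot_commute[of "pd ?b n x" "pd ?a n x"]
    by (simp add: v w pd_n_add pd_n_scaleR x cdot.add_left cdot.add_right cdot.scaleR_left
        cdot.scaleR_right scaleR_conv_of_real[where 'a=complex] algebra_simps)
  then have "cdot (pd v n x) (pd w n x) = lam / 2 * (p * r + q * s)"
    unfolding cf(3,4) by (simp add: algebra_simps)
  ultimately show ?thesis by simp
qed

text \<open>Koszul's formula for the metrics induced by \<open>F\<close> and \<open>n\<close>, which are proportional by \<open>conformal\<close>.\<close>
lemma koszul:
  assumes x: "x \<in> V"
  shows "cdot (pd v (pd w n) x) (pd z n x) = lam / 2 * mink (pd v (pd w F) x) (pd z F x)"
proof -
  have *: "cdot (pd w n x) (pd v (pd z n) x) + cdot (pd v (pd w n) x) (pd z n x) =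
    lam / 2 * (mink (pd w F x) (pd v (pd z F) x) + mink (pd v (pd w F) x) (pd z F x))" for v w z
  proof -
    have "pd v (\<lambda>x. cdot (pd w n x) (pd z n x)) x =
        pd v (\<lambda>x. complex_of_real (lam / 2 * mink (pd w F x) (pd z F x))) x"
      by (rule pd_cong_open[OF open_V x]) (simp add: conformal)
    also have "\<dots> = complex_of_real (lam / 2 * pd v (\<lambda>x. mink (pd w F x) (pd z F x)) x)"
      by (intro pd_bounded_linear smooth_on_differentiable[OF smooth_mink x] smooth_pd_F
          bounded_linear_compose[OF bounded_linear_of_real bounded_linear_mult_right])
    finally show ?thesis
      by (simp add: pd_cdot pd_mink smooth_on_pd smooth_n smooth_F x)
  qed
  note cn = pd_commute[OF open_V x smooth_n] and cF = pd_commute[OF open_V x smooth_F]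
  show ?thesis
    using *[of w v z] *[of v w z] *[of v z w] cn[of v z] cn[of w z] cn[of w v]
      cF[of v z] cF[of w z] cF[of w v]
    by (simp add: cdot_commute[of "pd w n x"] cdot_commute[of "pd v n x"] complex_eq_iff
        mink_commute[of "pd w F x"] mink_commute[of "pd v F x"] algebra_simps)
qed

text \<open>Differentiating \<open>koszul\<close> once more and eliminating the third derivatives gives the Gauss
  equations of \<open>F\<close> and \<open>n\<close>.\<close>
lemma gauss_equation:
  assumes x: "x \<in> V"
  shows "cdot (pd v (pd w n) x) (pd v (pd w n) x) - cdot (pd v (pd v n) x) (pd w (pd w n) x) =
    lam / 2 * (mink (pd v (pd w F) x) (pd v (pd w F) x) - mink (pd v (pd v F) x) (pd w (pd w F) x))"
proof -
  have *: "cdot (pd s (pd r n) x) (pd t (pd z n) x) + cdot (pd t (pd s (pd r n)) x) (pd z n x) =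
    lam / 2 * (mink (pd s (pd r F) x) (pd t (pd z F) x) + mink (pd t (pd s (pd r F)) x) (pd z F x))"
    for r s t z
  proof -
    have "pd t (\<lambda>x. cdot (pd s (pd r n) x) (pd z n x)) x =
        pd t (\<lambda>x. complex_of_real (lam / 2 * mink (pd s (pd r F) x) (pd z F x))) x"
      by (rule pd_cong_open[OF open_V x]) (simp add: koszul)
    also have "\<dots> = complex_of_real (lam / 2 * pd t (\<lambda>x. mink (pd s (pd r F) x) (pd z F x)) x)"
      by (intro pd_bounded_linear smooth_on_differentiable[OF smooth_mink x] smooth_on_pd smooth_F
          bounded_linear_compose[OF bounded_linear_of_real bounded_linear_mult_right])
    finally show ?thesis
      by (simp add: pd_cdot pd_mink smooth_on_pd smooth_n smooth_F x)
  qed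
  have third: "pd v (pd w (pd w f)) x = pd w (pd v (pd w f)) x"
    if "smooth_on V f" for f :: "real^2 \<Rightarrow> 'b::euclidean_space"
    by (rule pd_commute[OF open_V x smooth_on_pd[OF that]])
  have cn: "pd w (pd v n) x = pd v (pd w n) x" and cF: "pd w (pd v F) x = pd v (pd w F) x"
    by (rule pd_commute[OF open_V x], rule smooth_n smooth_F)+
  \<comment> \<open>Both instances pair a third derivative with \<open>pd v n\<close> or
    \<open>pd v F\<close>, and \<open>third\<close> identifies these third derivatives; subtraction
    leaves products of second derivatives.\<close>
  show ?thesis
    using *[of w w v v] *[of v w w v] third[OF smooth_n] third[OF smooth_F] cn cF
    by (simp add: cdot_commute[of "pd w (pd w n) x"] mink_commute[of "pd w (pd w F) x"]
        complex_eq_iff algebra_simps)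
qed

lemma lam_eq_0:
  assumes x: "x \<in> V"
  shows "lam = 0"
proof (rule ccontr)
  assume lam: "lam \<noteq> 0"
  define a b where "a = frame1 x" and "b = frame2 x"
  have o: "orthonormal_at x a b" and d: "det (vector [a, b] :: real^2^2) > 0"
    using frame[OF x] by (simp_all add: a_def b_def)
  note cf = conformal_at[OF x d o]
  define e1 e2 where "e1 = pd a F x" and "e2 = pd b F x"
  have e: "mink e1 e1 = 1" "mink e2 e2 = 1" "mink e1 e2 = 0" "mink e2 e1 = 0"
    using o by (auto simp: orthonormal_at_def e1_def e2_def mink_commute)
  define n0 n1 n2 where "n0 = n x" and "n1 = pd a n x" and "n2 = pd b n x"
  have nn: "cdot n0 n0 = 1" "cdot n0 n1 = 0" "cdot n0 n2 = 0" "cdot n1 n0 = 0" "cdot n2 n0 = 0"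
    "cdot n1 n1 = lam / 2" "cdot n2 n2 = lam / 2" "cdot n1 n2 = 0" "cdot n2 n1 = 0"
    using cf(3-5) cdot_n_n[OF x] cdot_n_pd[OF x] by (auto simp: n0_def n1_def n2_def cdot_commute)
  \<comment> \<open>The Gauss formula of the complex sphere. Since \<open>lam \<noteq> 0\<close>,
    products with \<open>n0\<close>, \<open>n1\<close>, \<open>n2\<close> determine a vector. In the
    tangential coefficients the factor \<open>lam / 2\<close> of \<open>koszul\<close> cancels
    against the squares of \<open>n1\<close> and \<open>n2\<close>, which leaves those of
    \<open>F\<close>.\<close>
  have hess: "pd v (pd w n) x = mink (pd v (pd w F) x) e1 *\<^sub>R n1 + mink (pd v (pd w F) x) e2 *\<^sub>R n2
      - (lam / 2 * mink (pd v F x) (pd w F x)) *\<^sub>R n0" for v w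
  proof -
    let ?y = "pd v (pd w n) x - (mink (pd v (pd w F) x) e1 *\<^sub>R n1 + mink (pd v (pd w F) x) e2 *\<^sub>R n2
      - (lam / 2 * mink (pd v F x) (pd w F x)) *\<^sub>R n0)"
    have "cdot n0 (pd v (pd w n) x) = - (lam / 2 * mink (pd v F x) (pd w F x))"
      using conformal[OF x, of w v] by (simp add: n0_def cdot_n_pd_pd x mink_commute)
    moreover have "cdot n1 (pd v (pd w n) x) = lam / 2 * mink (pd v (pd w F) x) e1"
      "cdot n2 (pd v (pd w n) x) = lam / 2 * mink (pd v (pd w F) x) e2"
      unfolding n1_def n2_def e1_def e2_def cdot_commute[of _ "pd v (pd w n) x"]
      by (rule koszul[OF x])+
    ultimately have "cdot n0 ?y = 0" "cdot n1 ?y = 0" "cdot n2 ?y = 0"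
      by (simp_all add: cdot.add_right cdot.diff_right cdot.scaleR_right nn scaleR_conv_of_real[where 'a=complex])
    then have "?y = 0"
      using lam by (intro cdot_orthogonal_basis[of n0 n1 n2]) (simp_all add: nn)
    then show ?thesis by simp
  qed
  define f11 f12 f22 where "f11 = pd a (pd a F) x" and "f12 = pd a (pd b F) x" and "f22 = pd b (pd b F) x"
  define \<alpha> \<beta> where "\<alpha> = normal_part x a b f11" and "\<beta> = normal_part x a b f12"
  have perp: "mink (normal_part x a b w) e1 = 0" "mink (normal_part x a b w) e2 = 0"
     "mink e1 (normal_part x a b w) = 0" "mink e2 (normal_part x a b w) = 0" for w
    by (simp_all add: normal_part_def mink.diff_left mink.scaleR_left mink.diff_right
        mink.scaleR_right e mink_commute[of e1 w] mink_commute[of e2 w] flip: e1_def e2_def)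
  have dec: "w = mink w e1 *\<^sub>R e1 + mink w e2 *\<^sub>R e2 + normal_part x a b w" for w
    by (simp add: normal_part_def e1_def e2_def)
  have prod: "mink v w = mink v e1 * mink w e1 + mink v e2 * mink w e2
      + mink (normal_part x a b v) (normal_part x a b w)" for v w
    by (subst dec[of v], subst dec[of w])
      (simp add: mink.add_left mink.add_right mink.scaleR_left mink.scaleR_right e perp)
  \<comment> \<open>The Christoffel terms, common to both Gauss equations. What remains beside
    \<open>P\<close> is the normal contribution: \<open>+ lam / 2\<close> from
    \<open>\<alpha>\<close> and \<open>\<beta>\<close> for \<open>F\<close>, but
    \<open>- lam / 2\<close> from the multiples of \<open>n0\<close> for the sphere.\<close>
  define P where "P = mink f12 e1 * mink f12 e1 + mink f12 e2 * mink f12 e2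
      - mink f11 e1 * mink f22 e1 - mink f11 e2 * mink f22 e2"
  have F: "mink f12 f12 - mink f11 f22 = P + lam / 2"
    unfolding P_def using cf(1,2) prod[of f12 f12] prod[of f11 f22]
    by (simp add: mink.minus_right flip: f11_def f12_def f22_def)
  have N: "cdot (pd a (pd b n) x) (pd a (pd b n) x) - cdot (pd a (pd a n) x) (pd b (pd b n) x)
    = complex_of_real (lam / 2 * (P - lam / 2))"
    unfolding P_def hess[of a] hess[of b] e1_def[symmetric] e2_def[symmetric]
      f11_def[symmetric] f12_def[symmetric] f22_def[symmetric]
    by (simp add: cdot.add_left cdot.diff_left cdot.add_right cdot.diff_right cdot.scaleR_left
        cdot.scaleR_right nn e scaleR_conv_of_real[where 'a=complex] algebra_simps)
  have "complex_of_real (lam / 2 * (P - lam / 2)) = complex_of_real (lam / 2 * (P + lam / 2))"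
    using gauss_equation[OF x, of a b]
    unfolding N f11_def[symmetric] f12_def[symmetric] f22_def[symmetric] F by simp
  then have "lam / 2 * (P - lam / 2) = lam / 2 * (P + lam / 2)" unfolding of_real_eq_iff .
  then have "lam * lam = 0" by (simp add: algebra_simps)
  then show False using lam by simp
qed

end

section \<open>Charts of a space-like surface\<close>

locale spacelike_surface =
  fixes S :: "'a surface"
  assumes oriented: "oriented_surface S" and space_like: "space_like S"
begin

lemma
  assumes c: "(V, \<psi>) \<in> atlas S"
  shows open_chart: "open V"
    and chart_points: "\<psi> ` V \<subseteq> points S"
    and openin_chart: "openin (top_space S) (\<psi> ` V)"
    and inj_on_chart: "inj_on \<psi> V"
    and chart_vimage: "openin (top_space S) Q \<Longrightarrow> open (V \<inter> \<psi> -` Q)"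
    and smooth_pos: "smooth_on V (pos S \<circ> \<psi>)"
proof -
  have oa: "oriented_atlas (top_space S) (atlas S)" using oriented by (simp add: oriented_surface_def)
  show V: "open V" and o: "openin (top_space S) (\<psi> ` V)"
    using oa c unfolding oriented_atlas_def by auto
  show P: "\<psi> ` V \<subseteq> points S" using o by (rule openin_subset)
  have hm: "homeomorphic_map (top_of_set V) (subtopology (top_space S) (\<psi> ` V)) \<psi>"
    using oa c unfolding oriented_atlas_def by auto
  then show "inj_on \<psi> V" using homeomorphic_imp_injective_map by fastforce
  show "open (V \<inter> \<psi> -` Q)" if "openin (top_space S) Q"
  proof -
    have "openin (subtopology (top_space S) (\<psi> ` V)) (Q \<inter> \<psi> ` V)"
      using that by (auto simp: openin_subtopology)
    from openin_continuous_map_preimage[OF homeomorphic_imp_continuous_map[OF hm] this]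
    have "openin (top_of_set V) {x \<in> V. \<psi> x \<in> Q \<inter> \<psi> ` V}" by simp
    moreover have "{x \<in> V. \<psi> x \<in> Q \<inter> \<psi> ` V} = V \<inter> \<psi> -` Q" by auto
    ultimately show ?thesis using V by (simp add: openin_open_eq)
  qed
  have "smooth_on (V \<inter> \<psi> -` points S) (pos S \<circ> \<psi>)"
    using oriented c unfolding oriented_surface_def smooth_map_on_def by blast
  moreover have "V \<inter> \<psi> -` points S = V" using P by auto
  ultimately show "smooth_on V (pos S \<circ> \<psi>)" by simp
qed

lemma transition:
  assumes c: "(V, \<psi>) \<in> atlas S" "(W, \<phi>) \<in> atlas S"
  defines "U \<equiv> W \<inter> \<phi> -` (\<psi> ` V)" and "\<tau> \<equiv> inv_into V \<psi> \<circ> \<phi>"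
  shows "open U" "smooth_on U \<tau>" "\<And>y. y \<in> U \<Longrightarrow> \<tau> y \<in> V" "\<And>y. y \<in> U \<Longrightarrow> \<psi> (\<tau> y) = \<phi> y"
    and "\<And>y. y \<in> U \<Longrightarrow> det (matrix (\<lambda>a. pd a \<tau> y)) > 0"
proof -
  have oa: "oriented_atlas (top_space S) (atlas S)" using oriented by (simp add: oriented_surface_def)
  show "open U" unfolding U_def by (rule chart_vimage[OF c(2) openin_chart[OF c(1)]])
  show "smooth_on U \<tau>" "\<And>y. y \<in> U \<Longrightarrow> det (matrix (\<lambda>a. pd a \<tau> y)) > 0"
    using oa c unfolding oriented_atlas_def U_def \<tau>_def pd_def by fast+
  show "\<tau> y \<in> V" "\<psi> (\<tau> y) = \<phi> y" if "y \<in> U" for y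
    using that by (auto simp: U_def \<tau>_def inv_into_into f_inv_into_f)
qed

text \<open>Changing the chart replaces the coordinate vector by its image under the transition map,
  the same for every \<open>f\<close>. Applied to \<open>pos S\<close> and to another function
  together, this makes the definitions independent of the chart.\<close>

lemma pd_transition:
  assumes c: "(V, \<psi>) \<in> atlas S" "(W, \<phi>) \<in> atlas S" and u: "u \<in> V" and w: "w \<in> W" "\<phi> w = \<psi> u"
    and f: "(f \<circ> \<psi>) differentiable (at u)"
  shows "pd a (f \<circ> \<phi>) w = pd (pd a (inv_into V \<psi> \<circ> \<phi>) w) (f \<circ> \<psi>) u"
proof -
  let ?\<tau> = "inv_into V \<psi> \<circ> \<phi>" and ?U = "W \<inter> \<phi> -` (\<psi> ` V)"
  note t = transition[OF c]
  have wU: "w \<in> ?U" using w u by auto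
  have tw: "?\<tau> w = u" using u w inj_on_chart[OF c(1)] by (simp add: inv_into_f_f)
  have "pd a (f \<circ> \<phi>) w = pd a (\<lambda>y. (f \<circ> \<psi>) (?\<tau> y)) w"
    by (rule pd_cong_open[OF t(1) wU]) (metis comp_apply t(4))
  also have "\<dots> = pd (pd a ?\<tau> w) (f \<circ> \<psi>) (?\<tau> w)"
    by (rule pd_compose) (use smooth_on_differentiable[OF t(2) wU] f tw in \<open>simp_all only:\<close>)
  finally show ?thesis unfolding tw .
qed

lemma tangent_plane_chart:
  assumes c: "(V, \<psi>) \<in> atlas S" and u: "u \<in> V"
  shows "tangent_plane S (\<psi> u) = range (\<lambda>a. pd a (pos S \<circ> \<psi>) u)"
proof
  show "range (\<lambda>a. pd a (pos S \<circ> \<psi>) u) \<subseteq> tangent_plane S (\<psi> u)"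
    using c u by (auto simp: tangent_plane_def pd_def)
  show "tangent_plane S (\<psi> u) \<subseteq> range (\<lambda>a. pd a (pos S \<circ> \<psi>) u)"
  proof
    fix w assume "w \<in> tangent_plane S (\<psi> u)"
    then obtain W \<phi> y a where "(W, \<phi>) \<in> atlas S" "y \<in> W" "\<phi> y = \<psi> u" "w = pd a (pos S \<circ> \<phi>) y"
      unfolding tangent_plane_def pd_def by blast
    then show "w \<in> range (\<lambda>a. pd a (pos S \<circ> \<psi>) u)"
      using pd_transition[OF c _ u] smooth_on_differentiable[OF smooth_pos[OF c] u] by blast
  qed
qed

lemma spacelike_chart:
  assumes c: "(V, \<psi>) \<in> atlas S"
  shows "spacelike_chart V (pos S \<circ> \<psi>)"
proof
  show "open V" "smooth_on V (pos S \<circ> \<psi>)" using open_chart[OF c] smooth_pos[OF c] .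
  fix x and a :: "real^2"
  assume x: "x \<in> V" and a: "a \<noteq> 0"
  have "inj (\<lambda>v. pd v (pos S \<circ> \<psi>) x)"
    using oriented c x unfolding oriented_surface_def pd_def by fast
  then have "pd a (pos S \<circ> \<psi>) x \<noteq> pd 0 (pos S \<circ> \<psi>) x" using a by (metis injD)
  then have "pd a (pos S \<circ> \<psi>) x \<noteq> 0"
    using linear_0[OF linear_pd[OF smooth_on_differentiable[OF smooth_pos[OF c] x]]] by simp
  moreover have "\<psi> x \<in> points S" using chart_points[OF c] x by blast
  ultimately show "mink (pd a (pos S \<circ> \<psi>) x) (pd a (pos S \<circ> \<psi>) x) > 0"
    using space_like tangent_plane_chart[OF c x] unfolding space_like_def by blast
qed

text \<open>A competing chart represents the same tangent vector. Transported to this chart, its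
  coordinate vector must be \<open>a\<close>, because the differential of the immersion is
  injective; hence it yields the same derivative of \<open>f\<close>.\<close>

lemma dir_deriv_chart:
  assumes c: "(V, \<psi>) \<in> atlas S" and u: "u \<in> V" and f: "(f \<circ> \<psi>) differentiable (at u)"
  shows "dir_deriv S f (\<psi> u) (pd a (pos S \<circ> \<psi>) u) = pd a (f \<circ> \<psi>) u"
  unfolding dir_deriv_def pd_def[symmetric]
proof (rule the_equality)
  interpret spacelike_chart V "pos S \<circ> \<psi>" by (rule spacelike_chart[OF c])
  show "\<exists>V \<psi>' u' a'. (V, \<psi>') \<in> atlas S \<and> u' \<in> V \<and> \<psi>' u' = \<psi> u \<and>
      pd a (pos S \<circ> \<psi>) u = pd a' (pos S \<circ> \<psi>') u' \<and> pd a (f \<circ> \<psi>) u = pd a' (f \<circ> \<psi>') u'"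
    using c u by blast
  fix d
  assume "\<exists>V \<psi>' u' a'. (V, \<psi>') \<in> atlas S \<and> u' \<in> V \<and> \<psi>' u' = \<psi> u \<and>
      pd a (pos S \<circ> \<psi>) u = pd a' (pos S \<circ> \<psi>') u' \<and> d = pd a' (f \<circ> \<psi>') u'"
  then obtain W \<phi> w b where *: "(W, \<phi>) \<in> atlas S" "w \<in> W" "\<phi> w = \<psi> u"
    "pd a (pos S \<circ> \<psi>) u = pd b (pos S \<circ> \<phi>) w" "d = pd b (f \<circ> \<phi>) w"
    by blast
  note tr = pd_transition[OF c *(1) u *(2,3)]
  have "pd a (pos S \<circ> \<psi>) u = pd (pd b (inv_into V \<psi> \<circ> \<phi>) w) (pos S \<circ> \<psi>) u"
    using *(4) tr[OF smooth_on_differentiable[OF smooth_pos[OF c] u]] by simp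
  then have "a = pd b (inv_into V \<psi> \<circ> \<phi>) w" using pd_F_cancel[OF u] by blast
  then show "d = pd a (f \<circ> \<psi>) u" using *(5) tr[OF f] by simp
qed

text \<open>A transition map multiplies the coordinate determinant by its Jacobian, which is
  positive in an oriented atlas.\<close>

lemma positive_tangent_basis_chart:
  assumes c: "(V, \<psi>) \<in> atlas S" and u: "u \<in> V"
  shows "positive_tangent_basis S (\<psi> u) v w \<longleftrightarrow>
    (\<exists>a b. v = pd a (pos S \<circ> \<psi>) u \<and> w = pd b (pos S \<circ> \<psi>) u \<and> det (vector [a, b] :: real^2^2) > 0)"
    (is "?L \<longleftrightarrow> ?R")
proof
  show "?R \<Longrightarrow> ?L" using c u unfolding positive_tangent_basis_def pd_def by blast
  assume ?L
  then obtain W \<phi> y a b where *: "(W, \<phi>) \<in> atlas S" "y \<in> W" "\<phi> y = \<psi> u"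
    "v = pd a (pos S \<circ> \<phi>) y" "w = pd b (pos S \<circ> \<phi>) y" "det (vector [a, b] :: real^2^2) > 0"
    unfolding positive_tangent_basis_def pd_def by blast
  let ?t = "\<lambda>a. pd a (inv_into V \<psi> \<circ> \<phi>) y"
  have yU: "y \<in> W \<inter> \<phi> -` (\<psi> ` V)" using * u by auto
  note t = transition[OF c *(1)]
  have lin: "linear ?t" by (rule linear_pd[OF smooth_on_differentiable[OF t(2) yU]])
  have "?t a $ i = matrix ?t $ i $ 1 * a $ 1 + matrix ?t $ i $ 2 * a $ 2" for a i
    using arg_cong[OF fun_cong[OF matrix_vector_mul(2)[OF lin, symmetric], of a], of "\<lambda>z. z $ i"]
    by (simp add: matrix_vector_mult_def sum_2 del: matrix_vector_mul)
  then have "det (vector [?t a, ?t b] :: real^2^2) = det (matrix ?t) * det (vector [a, b] :: real^2^2)"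
    by (simp add: det_2 algebra_simps)
  then have "det (vector [?t a, ?t b] :: real^2^2) > 0" using t(5)[OF yU] *(6) by simp
  moreover have "v = pd (?t a) (pos S \<circ> \<psi>) u" "w = pd (?t b) (pos S \<circ> \<psi>) u"
    using pd_transition[OF c *(1) u *(2,3) smooth_on_differentiable[OF smooth_pos[OF c] u]] *(4,5)
    by auto
  ultimately show ?R by blast
qed

lemma tan_part_chart:
  assumes c: "(V, \<psi>) \<in> atlas S" and x: "x \<in> V"
  shows "tan_part S (\<psi> x) w =
    pd (spacelike_chart.tangent_coord (pos S \<circ> \<psi>) x w) (pos S \<circ> \<psi>) x"
proof -
  interpret spacelike_chart V "pos S \<circ> \<psi>" by (rule spacelike_chart[OF c])
  show ?thesis unfolding tan_part_def tangent_plane_chart[OF c x]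
  proof (rule the_equality)
    show "pd (tangent_coord x w) (pos S \<circ> \<psi>) x \<in> range (\<lambda>a. pd a (pos S \<circ> \<psi>) x) \<and>
      (\<forall>s\<in>range (\<lambda>a. pd a (pos S \<circ> \<psi>) x). mink (w - pd (tangent_coord x w) (pos S \<circ> \<psi>) x) s = 0)"
      using mink_diff_tangent_coord[OF x] by blast
    fix t
    assume "t \<in> range (\<lambda>a. pd a (pos S \<circ> \<psi>) x) \<and>
      (\<forall>s\<in>range (\<lambda>a. pd a (pos S \<circ> \<psi>) x). mink (w - t) s = 0)"
    then obtain a where t: "t = pd a (pos S \<circ> \<psi>) x" "\<And>b. mink (w - t) (pd b (pos S \<circ> \<psi>) x) = 0"
      by blast
    have "tangent_coord x (w - t) = 0" by (simp add: tangent_coord_def t(2))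
    then have "tangent_coord x w = a"
      using linear_diff[OF linear_tangent_coord, of x w t] tangent_coord_pd[OF x] t(1) by simp
    then show "t = pd (tangent_coord x w) (pos S \<circ> \<psi>) x" using t(1) by simp
  qed
qed

text \<open>Provides the witness without which the descriptions of the Laplacian and of the mean
  curvature would be void: the smooth orthonormal frame of the parameter domain, carried to the
  surface.\<close>

lemma exists_tangent_frame:
  assumes c: "(V, \<psi>) \<in> atlas S"
  obtains e1 e2 where "local_tangent_frame S (\<psi> ` V) e1 e2"
proof -
  interpret spacelike_chart V "pos S \<circ> \<psi>" by (rule spacelike_chart[OF c])
  have sm: "smooth_map_on S (\<psi> ` V) (\<lambda>q. E (inv_into V \<psi> q))" if E: "smooth_on V E" for E :: "real^2 \<Rightarrow> minkowski"
    unfolding smooth_map_on_def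
  proof (intro ballI, clarify)
    fix W \<phi> assume c': "(W, \<phi>) \<in> atlas S"
    note t = transition[OF c c']
    have "smooth_on (W \<inter> \<phi> -` (\<psi> ` V)) (\<lambda>y. E ((inv_into V \<psi> \<circ> \<phi>) y))"
      by (rule smooth_on_compose[OF t(1) E t(2)]) (use t(3) in blast)
    then show "smooth_on (W \<inter> \<phi> -` \<psi> ` V) ((\<lambda>q. E (inv_into V \<psi> q)) \<circ> \<phi>)"
      by (simp add: o_def)
  qed
  have "local_tangent_frame S (\<psi> ` V)
      (\<lambda>q. (\<lambda>y. pd (frame1 y) (pos S \<circ> \<psi>) y) (inv_into V \<psi> q))
      (\<lambda>q. (\<lambda>y. pd (frame2 y) (pos S \<circ> \<psi>) y) (inv_into V \<psi> q))"
    unfolding local_tangent_frame_def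
  proof (intro conjI sm smooth_on_pd_field open_V smooth_frame smooth_F openin_chart[OF c] ballI)
    fix q assume "q \<in> \<psi> ` V"
    then obtain x where x: "x \<in> V" "q = \<psi> x" by blast
    then have iv: "inv_into V \<psi> q = x" using inj_on_chart[OF c] by simp
    show "pd (frame1 (inv_into V \<psi> q)) (pos S \<circ> \<psi>) (inv_into V \<psi> q) \<in> tangent_plane S q"
      "pd (frame2 (inv_into V \<psi> q)) (pos S \<circ> \<psi>) (inv_into V \<psi> q) \<in> tangent_plane S q"
      unfolding iv unfolding x(2) tangent_plane_chart[OF c x(1)] by blast+
  qed (use frame(1) inj_on_chart[OF c] in \<open>auto simp: orthonormal_at_def\<close>)
  then show thesis by (rule that)
qed

text \<open>With coordinates \<open>a\<close> of a tangent field \<open>e\<close> in a chart, the derivatives of \<open>a\<close> cancel in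
  \<open>\<nabla>\<^sub>e e - e e\<close> and in the second fundamental form.\<close>
lemma frame_vector_chart:
  assumes c: "(V, \<psi>) \<in> atlas S" and x: "x \<in> V"
    and Q: "openin (top_space S) Q" "\<psi> x \<in> Q" and e: "smooth_map_on S Q e"
    and tang: "\<And>q. q \<in> Q \<Longrightarrow> e q \<in> tangent_plane S q"
  defines "F \<equiv> pos S \<circ> \<psi>"
  obtains a where "e (\<psi> x) = pd a F x"
    and "second_fundamental_form S e e (\<psi> x) =
      pd a (pd a F) x - pd (spacelike_chart.tangent_coord F x (pd a (pd a F) x)) F x"
    and "\<And>f :: 'a \<Rightarrow> 'b::real_normed_vector. smooth_on V (f \<circ> \<psi>) \<Longrightarrow>
      dir_deriv S f (\<psi> x) (connection S e e (\<psi> x)) - dir_deriv S (\<lambda>q. dir_deriv S f q (e q)) (\<psi> x) (e (\<psi> x)) =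
      pd (spacelike_chart.tangent_coord F x (pd a (pd a F) x)) (f \<circ> \<psi>) x - pd a (pd a (f \<circ> \<psi>)) x"
proof -
  interpret spacelike_chart V F unfolding F_def by (rule spacelike_chart[OF c])
  define U where "U = V \<inter> \<psi> -` Q"
  have U: "open U" "U \<subseteq> V" "x \<in> U"
    using chart_vimage[OF c Q(1)] x Q(2) by (auto simp: U_def)
  have se: "smooth_on U (e \<circ> \<psi>)" using e c unfolding smooth_map_on_def U_def by blast
  define a where "a y = tangent_coord y (e (\<psi> y))" for y
  have sa: "smooth_on U a"
    using smooth_tangent_coord[OF U(1,2) se] by (simp add: a_def[abs_def])
  have ea: "e (\<psi> y) = pd (a y) F y" if "y \<in> U" for y
  proof -
    have "y \<in> V" "\<psi> y \<in> Q" using that by (auto simp: U_def)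
    then obtain b where "e (\<psi> y) = pd b F y"
      using tang tangent_plane_chart[OF c] unfolding F_def by blast
    then show ?thesis using tangent_coord_pd[OF \<open>y \<in> V\<close>] by (simp add: a_def)
  qed
  \<comment> \<open>One computation for two uses: \<open>h = F\<close> gives the flat derivative of
    the field itself, and \<open>h = f \<circ> \<psi>\<close> the iterated derivative of a
    function.\<close>
  have second: "dir_deriv S g (\<psi> x) (e (\<psi> x)) =
      pd (pd (a x) a x) h x + pd (a x) (pd (a x) h) x"
    if g: "\<And>y. y \<in> U \<Longrightarrow> g (\<psi> y) = pd (a y) h y" and h: "smooth_on V h"
    for g :: "'a \<Rightarrow> 'd::real_normed_vector" and h
  proof -
    have hU: "smooth_on U h" by (rule smooth_on_subset[OF h U(2)])
    have gh: "(g \<circ> \<psi>) y = pd (a y) h y" if "y \<in> U" for y using g[OF that] by simp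
    have sg: "smooth_on U (g \<circ> \<psi>)"
      by (subst smooth_on_cong[OF U(1) gh], assumption) (rule smooth_on_pd_field[OF U(1) sa hU])
    have "dir_deriv S g (\<psi> x) (e (\<psi> x)) = pd (a x) (g \<circ> \<psi>) x"
      unfolding ea[OF U(3)] F_def
      by (rule dir_deriv_chart[OF c x smooth_on_differentiable[OF sg U(3)]])
    also have "\<dots> = pd (a x) (\<lambda>y. pd (a y) h y) x"
      by (rule pd_cong_open[OF U(1,3) gh])
    finally show ?thesis using pd_pd_field[OF U(1) sa hU U(3)] by simp
  qed
  have ee: "dir_deriv S e (\<psi> x) (e (\<psi> x)) =
      pd (pd (a x) a x) F x + pd (a x) (pd (a x) F) x"
    by (rule second[OF ea smooth_F])
  have conn: "connection S e e (\<psi> x) =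
      pd (pd (a x) a x + tangent_coord x (pd (a x) (pd (a x) F) x)) F x"
    unfolding connection_def ee tan_part_chart[OF c x] F_def[symmetric]
    by (simp add: linear_add[OF linear_tangent_coord] tangent_coord_pd x)
  show thesis
  proof (rule that)
    show "e (\<psi> x) = pd (a x) F x" by (rule ea[OF U(3)])
    show "second_fundamental_form S e e (\<psi> x) =
      pd (a x) (pd (a x) F) x - pd (tangent_coord x (pd (a x) (pd (a x) F) x)) F x"
      unfolding second_fundamental_form_def conn ee by (simp add: pd_F_add x)
    fix f :: "'a \<Rightarrow> 'b"
    assume f: "smooth_on V (f \<circ> \<psi>)"
    have df: "dir_deriv S f (\<psi> y) (pd b F y) = pd b (f \<circ> \<psi>) y" if "y \<in> V" for y b
      unfolding F_def by (rule dir_deriv_chart[OF c that smooth_on_differentiable[OF f that]])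
    have "dir_deriv S (\<lambda>q. dir_deriv S f q (e q)) (\<psi> x) (e (\<psi> x)) =
       pd (pd (a x) a x) (f \<circ> \<psi>) x + pd (a x) (pd (a x) (f \<circ> \<psi>)) x"
      by (rule second[OF _ f]) (use ea df U(2) in auto)
    then show "dir_deriv S f (\<psi> x) (connection S e e (\<psi> x)) -
        dir_deriv S (\<lambda>q. dir_deriv S f q (e q)) (\<psi> x) (e (\<psi> x)) =
      pd (tangent_coord x (pd (a x) (pd (a x) F) x)) (f \<circ> \<psi>) x - pd (a x) (pd (a x) (f \<circ> \<psi>)) x"
      unfolding conn df[OF x]
      using linear_add[OF linear_pd[OF smooth_on_differentiable[OF f x]]] by simp
  qed
qed

text \<open>\<open>B\<close> is minus the covariant Hessian of \<open>f\<close>, written in the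
  parameter plane. It is symmetric and bilinear, so its trace is the same for all orthonormal pairs,
  and every local frame yields the value that \<open>a\<close> and \<open>b\<close> give.\<close>

lemma laplacian_chart:
  fixes f :: "'a \<Rightarrow> 'b::euclidean_space"
  assumes c: "(V, \<psi>) \<in> atlas S" and x: "x \<in> V" and f: "smooth_on V (f \<circ> \<psi>)"
  defines "F \<equiv> pos S \<circ> \<psi>"
  assumes o: "spacelike_chart.orthonormal_at F x a b"
  shows "laplacian S f (\<psi> x) =
    pd (spacelike_chart.tangent_coord F x (pd a (pd a F) x + pd b (pd b F) x)) (f \<circ> \<psi>) x
    - (pd a (pd a (f \<circ> \<psi>)) x + pd b (pd b (f \<circ> \<psi>)) x)" (is "_ = ?r")
proof -
  interpret spacelike_chart V F unfolding F_def by (rule spacelike_chart[OF c])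
  define B where "B v w = pd (tangent_coord x (pd v (pd w F) x)) (f \<circ> \<psi>) x - pd v (pd w (f \<circ> \<psi>)) x" for v w
  have lf: "linear (\<lambda>v. pd v (f \<circ> \<psi>) x)"
    by (rule linear_pd[OF smooth_on_differentiable[OF f x]])
  have r: "?r = B a a + B b b"
    by (simp add: B_def linear_add[OF linear_tangent_coord] linear_add[OF lf])
  have sym: "B v w = B w v" for v w
    unfolding B_def using pd_commute[OF open_V x smooth_F] pd_commute[OF open_V x f] by metis
  have "linear (\<lambda>v. B v w)" for w
    unfolding B_def
    using linear_compose_sub[OF linear_compose[OF linear_compose[OF
          linear_pd[OF smooth_on_differentiable[OF smooth_pd_F x]] linear_tangent_coord] lf]
        linear_pd[OF smooth_on_differentiable[OF smooth_on_pd[OF f] x]]]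
    by (simp add: o_def)
  then have lin: "linear (B w)" for w unfolding sym[of w, abs_def] .
  have frame: "(\<Sum>e\<leftarrow>[e1, e2]. dir_deriv S f (\<psi> x) (connection S e e (\<psi> x))
      - dir_deriv S (\<lambda>q. dir_deriv S f q (e q)) (\<psi> x) (e (\<psi> x))) = B a a + B b b"
    if Q: "\<psi> x \<in> Q" and fr: "local_tangent_frame S Q e1 e2" for Q e1 e2
  proof -
    note fr' = fr[unfolded local_tangent_frame_def]
    have *: "\<exists>a'. e (\<psi> x) = pd a' F x \<and> dir_deriv S f (\<psi> x) (connection S e e (\<psi> x))
        - dir_deriv S (\<lambda>q. dir_deriv S f q (e q)) (\<psi> x) (e (\<psi> x)) = B a' a'"
      if e: "smooth_map_on S Q e" "\<And>q. q \<in> Q \<Longrightarrow> e q \<in> tangent_plane S q" for e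
    proof (rule frame_vector_chart[OF c x _ Q e, where 'b = 'b, folded F_def])
      show "openin (top_space S) Q" using fr' by blast
      fix a'
      assume "e (\<psi> x) = pd a' F x"
        and "\<And>f :: 'a \<Rightarrow> 'b. smooth_on V (f \<circ> \<psi>) \<Longrightarrow>
          dir_deriv S f (\<psi> x) (connection S e e (\<psi> x))
          - dir_deriv S (\<lambda>q. dir_deriv S f q (e q)) (\<psi> x) (e (\<psi> x)) =
          pd (tangent_coord x (pd a' (pd a' F) x)) (f \<circ> \<psi>) x - pd a' (pd a' (f \<circ> \<psi>)) x"
      then show ?thesis unfolding B_def using f by blast
    qed
    obtain a' b' where a': "e1 (\<psi> x) = pd a' F x"
        "dir_deriv S f (\<psi> x) (connection S e1 e1 (\<psi> x))
          - dir_deriv S (\<lambda>q. dir_deriv S f q (e1 q)) (\<psi> x) (e1 (\<psi> x)) = B a' a'"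
      and b': "e2 (\<psi> x) = pd b' F x"
        "dir_deriv S f (\<psi> x) (connection S e2 e2 (\<psi> x))
          - dir_deriv S (\<lambda>q. dir_deriv S f q (e2 q)) (\<psi> x) (e2 (\<psi> x)) = B b' b'"
      using *[of e1] *[of e2] fr' by blast
    have "orthonormal_at x a' b'"
      using fr' Q unfolding orthonormal_at_def a'(1)[symmetric] b'(1)[symmetric] by blast
    then have "B a' a' + B b' b' = B a a + B b b"
      by (rule trace_orthonormal[OF x o _ lin sym])
    then show ?thesis using a'(2) b'(2) by simp
  qed
  obtain e1 e2 where fr: "local_tangent_frame S (\<psi> ` V) e1 e2" using exists_tangent_frame[OF c] .
  have px: "\<psi> x \<in> \<psi> ` V" using x by blast
  show ?thesis unfolding r laplacian_def
  proof (rule the_equality)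
    show "\<exists>Q e1 e2. \<psi> x \<in> Q \<and> local_tangent_frame S Q e1 e2 \<and> B a a + B b b =
      (\<Sum>e\<leftarrow>[e1, e2]. dir_deriv S f (\<psi> x) (connection S e e (\<psi> x))
        - dir_deriv S (\<lambda>q. dir_deriv S f q (e q)) (\<psi> x) (e (\<psi> x)))"
      using px fr frame[OF px fr, symmetric] by blast
  qed (use frame in blast)
qed

text \<open>The trace argument again, with \<open>B\<close> now the second fundamental form in the
  parameter plane.\<close>

lemma mean_curvature_chart:
  assumes c: "(V, \<psi>) \<in> atlas S" and x: "x \<in> V"
  defines "F \<equiv> pos S \<circ> \<psi>"
  assumes o: "spacelike_chart.orthonormal_at F x a b"
  shows "mean_curvature S (\<psi> x) = (1/2) *\<^sub>R (pd a (pd a F) x + pd b (pd b F) x -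
    pd (spacelike_chart.tangent_coord F x (pd a (pd a F) x + pd b (pd b F) x)) F x)" (is "_ = ?r")
proof -
  interpret spacelike_chart V F unfolding F_def by (rule spacelike_chart[OF c])
  define B where "B v w = pd v (pd w F) x - pd (tangent_coord x (pd v (pd w F) x)) F x" for v w
  have r: "?r = (1/2) *\<^sub>R (B a a + B b b)"
    by (simp add: B_def linear_add[OF linear_tangent_coord] pd_F_add x)
  have sym: "B v w = B w v" for v w
    unfolding B_def using pd_commute[OF open_V x smooth_F] by metis
  have "linear (\<lambda>v. B v w)" for w
    unfolding B_def
    using linear_compose_sub[OF linear_pd[OF smooth_on_differentiable[OF smooth_pd_F x]]
        linear_compose[OF linear_compose[OF
          linear_pd[OF smooth_on_differentiable[OF smooth_pd_F x]] linear_tangent_coord] linear_F[OF x]]]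
    by (simp add: o_def)
  then have lin: "linear (B w)" for w unfolding sym[of w, abs_def] .
  have frame: "(1/2) *\<^sub>R (second_fundamental_form S e1 e1 (\<psi> x) + second_fundamental_form S e2 e2 (\<psi> x))
      = ?r"
    if Q: "\<psi> x \<in> Q" and fr: "local_tangent_frame S Q e1 e2" for Q e1 e2
  proof -
    note fr' = fr[unfolded local_tangent_frame_def]
    have *: "\<exists>a'. e (\<psi> x) = pd a' F x \<and> second_fundamental_form S e e (\<psi> x) = B a' a'"
      if e: "smooth_map_on S Q e" "\<And>q. q \<in> Q \<Longrightarrow> e q \<in> tangent_plane S q" for e
    proof (rule frame_vector_chart[OF c x _ Q e, folded F_def])
      show "openin (top_space S) Q" using fr' by blast
      fix a'
      assume "e (\<psi> x) = pd a' F x"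
        and "second_fundamental_form S e e (\<psi> x) =
          pd a' (pd a' F) x - pd (tangent_coord x (pd a' (pd a' F) x)) F x"
      then show ?thesis unfolding B_def by blast
    qed
    obtain a' b' where a': "e1 (\<psi> x) = pd a' F x" "second_fundamental_form S e1 e1 (\<psi> x) = B a' a'"
      and b': "e2 (\<psi> x) = pd b' F x" "second_fundamental_form S e2 e2 (\<psi> x) = B b' b'"
      using *[of e1] *[of e2] fr' by blast
    have "orthonormal_at x a' b'"
      using fr' Q unfolding orthonormal_at_def a'(1)[symmetric] b'(1)[symmetric] by blast
    then have "B a' a' + B b' b' = B a a + B b b"
      by (rule trace_orthonormal[OF x o _ lin sym])
    then show ?thesis unfolding r using a'(2) b'(2) by simp
  qed
  obtain e1 e2 where fr: "local_tangent_frame S (\<psi> ` V) e1 e2" using exists_tangent_frame[OF c] .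
  have px: "\<psi> x \<in> \<psi> ` V" using x by blast
  show ?thesis unfolding mean_curvature_def
  proof (rule the_equality)
    show "\<exists>Q e1 e2. \<psi> x \<in> Q \<and> local_tangent_frame S Q e1 e2 \<and> ?r =
      (1/2) *\<^sub>R (second_fundamental_form S e1 e1 (\<psi> x) + second_fundamental_form S e2 e2 (\<psi> x))"
      using px fr frame[OF px fr, symmetric] by blast
  qed (use frame in blast)
qed

text \<open>An explicit formula without normal vectors: the normal bivector is determined by the
  tangent one, which by orientation is the same for all positive orthonormal bases. Existence of an
  adapted frame completes the description.\<close>

lemma gauss_map_chart:
  assumes c: "(V, \<psi>) \<in> atlas S" and x: "x \<in> V"
  defines "F \<equiv> pos S \<circ> \<psi>"
  assumes d: "det (vector [a, b] :: real^2^2) > 0"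
  shows "gauss_map S (\<psi> x) = of_complex3
    (spacelike_chart.gram F a b x powr (-1/2) *\<^sub>R cwedge (pd a F x) (pd b F x))" (is "_ = ?r")
proof -
  interpret spacelike_chart V F unfolding F_def by (rule spacelike_chart[OF c])
  have eq: "wedge e3 e4 = ?r" if fr: "adapted_frame_at S (\<psi> x) e1 e2 e3 e4" for e1 e2 e3 e4
  proof -
    have pt: "positive_tangent_basis S (\<psi> x) e1 e2"
      and tang: "mink e3 (pd v F x) = 0" "mink e4 (pd v F x) = 0" for v
      using fr tangent_plane_chart[OF c x] unfolding adapted_frame_at_def F_def by blast+
    obtain v w where vw: "e1 = pd v F x" "e2 = pd w F x" "det (vector [v, w] :: real^2^2) > 0"
      using pt unfolding positive_tangent_basis_chart[OF c x] F_def by blast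
    have "orthonormal_at x v w"
      using fr unfolding adapted_frame_at_def orthonormal_at_def vw by blast
    then have "cwedge e1 e2 = gram a b x powr (-1/2) *\<^sub>R cwedge (pd a F x) (pd b F x)"
      unfolding vw by (rule cwedge_orthonormal[OF x _ vw(3) d])
    moreover have "to_complex3 (wedge e3 e4) = cwedge e1 e2"
      by (rule to_complex3_wedge_normal) (use fr tang vw in \<open>auto simp: adapted_frame_at_def\<close>)
    ultimately show ?thesis by (metis of_complex3_to_complex3_wedge)
  qed
  have ex: "\<exists>e1 e2 e3 e4. adapted_frame_at S (\<psi> x) e1 e2 e3 e4"
  proof -
    let ?e1 = "pd (frame1 x) F x" and ?e2 = "pd (frame2 x) F x"
    have o: "mink ?e1 ?e1 = 1" "mink ?e2 ?e2 = 1" "mink ?e1 ?e2 = 0"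
      using frame(1)[OF x] by (auto simp: orthonormal_at_def)
    obtain e3 e4 where n: "mink e3 ?e1 = 0" "mink e3 ?e2 = 0" "mink e4 ?e1 = 0" "mink e4 ?e2 = 0"
      "mink e3 e3 = 1" "mink e4 e4 = -1" "mink e3 e4 = 0" "det4 ?e1 ?e2 e3 e4 > 0"
      using exists_normal_frame[OF o] .
    have "positive_tangent_basis S (\<psi> x) ?e1 ?e2"
      unfolding positive_tangent_basis_chart[OF c x] F_def[symmetric] using frame(2)[OF x] by blast
    moreover have "mink e3 v = 0 \<and> mink e4 v = 0" if "v \<in> tangent_plane S (\<psi> x)" for v
    proof -
      obtain s where "v = pd s F x"
        using \<open>v \<in> tangent_plane S (\<psi> x)\<close> unfolding tangent_plane_chart[OF c x] F_def by blast
      moreover obtain p q where "s = p *\<^sub>R frame1 x + q *\<^sub>R frame2 x"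
        using plane_basis[of "frame1 x" "frame2 x" s] frame(2)[OF x] by auto
      ultimately show ?thesis by (simp add: pd_F_add pd_F_scaleR x mink.add_right mink.scaleR_right n)
    qed
    ultimately have "adapted_frame_at S (\<psi> x) ?e1 ?e2 e3 e4"
      unfolding adapted_frame_at_def using o n by simp
    then show ?thesis by blast
  qed
  show ?thesis unfolding gauss_map_def
  proof (rule the_equality)
    show "\<exists>e1 e2 e3 e4. adapted_frame_at S (\<psi> x) e1 e2 e3 e4 \<and> ?r = wedge e3 e4"
      using ex eq by metis
  qed (use eq in blast)
qed

lemma smooth_gauss_map:
  assumes c: "(V, \<psi>) \<in> atlas S"
  shows "smooth_on V (gauss_map S \<circ> \<psi>)"
proof -
  interpret spacelike_chart V "pos S \<circ> \<psi>" by (rule spacelike_chart[OF c])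
  have "smooth_on V (\<lambda>x. of_complex3 (gram (axis 1 1) (axis 2 1) x powr (-1/2) *\<^sub>R
      cwedge (pd (axis 1 1) (pos S \<circ> \<psi>) x) (pd (axis 2 1) (pos S \<circ> \<psi>) x)))"
    by (intro smooth_on_bounded_linear[OF open_V bounded_linear_of_complex3] smooth_on_scaleR
        smooth_on_powr smooth_gram frame_pos open_V smooth_pd_F
        smooth_on_bilinear[OF open_V bounded_bilinear_cwedge])
  then show ?thesis
    using smooth_on_cong[OF open_V gauss_map_chart[OF c, of _ "axis 1 1" "axis 2 1"]]
    by (simp add: det_axis o_def)
qed

end

section \<open>From charts to the surface\<close>

theorem proposition4p3:
  fixes M :: "'a surface"
  assumes "oriented_surface M"
    and "maximal_surface M"
  shows "has_one_type_gauss_map_first_kind M \<longleftrightarrow> harmonic M (gauss_map M)"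
proof
  assume "harmonic M (gauss_map M)"
  then show "has_one_type_gauss_map_first_kind M"
    unfolding harmonic_def has_one_type_gauss_map_first_kind_def by (intro exI[of _ 0]) simp
next
  assume "has_one_type_gauss_map_first_kind M"
  then obtain lam where lam: "\<And>p. p \<in> points M \<Longrightarrow> laplacian M (gauss_map M) p = lam *\<^sub>R gauss_map M p"
    unfolding has_one_type_gauss_map_first_kind_def by blast
  interpret spacelike_surface M
    using assms by unfold_locales (auto simp: maximal_surface_def)
  \<comment> \<open>Claimed only in the presence of a point: on an empty surface \<open>lam\<close>
    is arbitrary and harmonicity is vacuous.\<close>
  have "lam = 0" if "p \<in> points M" for p
  proof -
    have "oriented_atlas (top_space M) (atlas M)"
      using assms(1) by (simp add: oriented_surface_def)
    then have "p \<in> (\<Union>(V, \<psi>)\<in>atlas M. \<psi> ` V)" using that by (simp add: oriented_atlas_def)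
    then obtain V \<psi> u where c: "(V, \<psi>) \<in> atlas M" and u: "u \<in> V" by auto
    define F where "F = pos M \<circ> \<psi>"
    define G where "G = gauss_map M \<circ> \<psi>"
    have G: "smooth_on V G" unfolding G_def by (rule smooth_gauss_map[OF c])
    interpret spacelike_chart V F unfolding F_def by (rule spacelike_chart[OF c])
    interpret maximal_chart V F "\<lambda>x. to_complex3 (G x)" lam
    proof
      show "smooth_on V (\<lambda>x. to_complex3 (G x))"
        by (rule smooth_on_bounded_linear[OF open_V bounded_linear_to_complex3 G])
      show "to_complex3 (G x) = gram a b x powr (-1/2) *\<^sub>R cwedge (pd a F x) (pd b F x)"
        if "x \<in> V" "det (vector [a, b] :: real^2^2) > 0" for x a b
        unfolding G_def F_def comp_apply gauss_map_chart[OF c that] by simp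
      fix x and a b :: "real^2"
      assume x: "x \<in> V" and d: "det (vector [a, b] :: real^2^2) > 0" and o: "orthonormal_at x a b"
      \<comment> \<open>The coordinates of the tangential part of the sum of second derivatives.
        Zero mean curvature says that this sum equals its tangential part, and the same vector
        enters the chart formula of the Laplacian.\<close>
      let ?c = "tangent_coord x (pd a (pd a F) x + pd b (pd b F) x)"
      have px: "\<psi> x \<in> points M" using chart_points[OF c] x by blast
      then have "mean_curvature M (\<psi> x) = 0" using assms(2) by (simp add: maximal_surface_def)
      then have "pd ?c F x = pd a (pd a F) x + pd b (pd b F) x"
        using mean_curvature_chart[OF c x o[unfolded F_def]] by (simp add: F_def[symmetric])
      moreover
      have L: "pd v (\<lambda>x. to_complex3 (g x)) y = to_complex3 (pd v g y)" if "smooth_on V g" "y \<in> V" for v g y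
        by (rule pd_bounded_linear[OF bounded_linear_to_complex3 smooth_on_differentiable[OF that]])
      have L2: "pd v (pd v (\<lambda>x. to_complex3 (G x))) x = to_complex3 (pd v (pd v G) x)" for v
      proof -
        have "pd v (pd v (\<lambda>x. to_complex3 (G x))) x = pd v (\<lambda>x. to_complex3 (pd v G x)) x"
          by (rule pd_cong_open[OF open_V x]) (rule L[OF G])
        then show ?thesis using L[OF smooth_on_pd[OF G] x] by simp
      qed
      have "laplacian M (gauss_map M) (\<psi> x) = pd ?c G x - (pd a (pd a G) x + pd b (pd b G) x)"
        using laplacian_chart[OF c x smooth_gauss_map[OF c] o[unfolded F_def]]
        by (simp add: F_def[symmetric] G_def[symmetric])
      then have "pd a (pd a G) x + pd b (pd b G) x - pd ?c G x = - lam *\<^sub>R G x"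
        using lam[OF px] by (simp add: G_def)
      then have "to_complex3 (pd a (pd a G) x + pd b (pd b G) x - pd ?c G x) = to_complex3 (- lam *\<^sub>R G x)"
        by simp
      then have "pd a (pd a (\<lambda>x. to_complex3 (G x))) x + pd b (pd b (\<lambda>x. to_complex3 (G x))) x
          - pd ?c (\<lambda>x. to_complex3 (G x)) x = - lam *\<^sub>R to_complex3 (G x)"
        unfolding L2 L[OF G x]
        by (simp only: bounded_linear.linear[OF bounded_linear_to_complex3] linear_add linear_diff linear_cmul)
      ultimately show "\<exists>c. pd c F x = pd a (pd a F) x + pd b (pd b F) x \<and>
          pd a (pd a (\<lambda>x. to_complex3 (G x))) x + pd b (pd b (\<lambda>x. to_complex3 (G x))) x
          - pd c (\<lambda>x. to_complex3 (G x)) x = - lam *\<^sub>R to_complex3 (G x)"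
        by blast
    qed
    show "lam = 0" by (rule lam_eq_0[OF u])
  qed
  then show "harmonic M (gauss_map M)"
    unfolding harmonic_def using lam by (metis scaleR_zero_left)
qed

end
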